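(* Let $n$ be a positive integer. For every partition $\mu$ of $n$ with $(1^n)\le\mu\le(3,1^{n-3})$ in reverse lexicographic order, $\psi_\mu$ is Schur-positive. Equivalently: (1) for every integer $k$ with $0\le k\le n/2$, the symmetric function $\psi_{(2^k,1^{n-2k})}=\sum_{i=0}^k p_2^i p_1^{n-2i}$ is Schur-positive (and $\psi_{(2^{k+1},1^{n-2k-2})}=\psi_{(2^k,1^{n-2k})}+p_2^{k+1}p_1^{n-2k-2}$ for $0\le k<n/2$); (2) for $n\ge 3$, the symmetric function $\psi_{(3,1^{n-3})}=p_3p_1^{n-3}+\psi_{(2^k,1^{n-2k})}$, where $k=\lfloor n/2\rfloor$, is Schur-positive.
   Context: $p_\lambda=\prod_i p_{\lambda_i}$ denotes the power sum symmetric function. Reverse lexicographic order on partitions of $n$ is the total order in which, for distinct partitions $\lambda,\mu$ of $n$, $\lambda>\mu$ iff $\lambda_j>\mu_j$ at the first index $j$ where they differ; $(1^n)$ is the minimum and $(n)$ the maximum. For a partition $\mu$ of $n$, $\psi_\mu=\sum_{\lambda\vdash n,\ (1^n)\le\lambda\le\mu}p_\lambda$. Schur-positive means a nonnegative integer combination of Schur functions. *)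

theory Defs
  imports Main "HOL-Library.Poly_Mapping"
begin

(* Polynomials with integer coefficients in the variables x_0, x_1, ...:
   a monomial is an exponent vector (nat \<Rightarrow>\<^sub>0 nat), a polynomial a finitely
   supported map from monomials to int. *)
type_synonym ipoly = "(nat \<Rightarrow>\<^sub>0 nat) \<Rightarrow>\<^sub>0 int"

(* A symmetric function is represented by its family of restrictions to
   the first N variables x_0..x_{N-1}, for every N. *)
type_synonym symfun = "nat \<Rightarrow> ipoly"

definition is_partition :: "nat list \<Rightarrow> bool" where
  "is_partition \<nu> \<longleftrightarrow> sorted_wrt (\<ge>) \<nu> \<and> (\<forall>x\<in>set \<nu>. 0 < x)"

definition partitions :: "nat \<Rightarrow> nat list set" where
  "partitions n = {\<nu>. is_partition \<nu> \<and> sum_list \<nu> = n}"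

definition revlex_le :: "nat list \<Rightarrow> nat list \<Rightarrow> bool" where
  "revlex_le la \<mu> \<longleftrightarrow> la = \<mu> \<or>
     (\<exists>j. j < length la \<and> j < length \<mu> \<and> take j la = take j \<mu> \<and> la ! j < \<mu> ! j)"

definition power_sum :: "nat \<Rightarrow> symfun" where
  "power_sum r N = (\<Sum>i<N. Poly_Mapping.single (Poly_Mapping.single i r) 1)"

definition power_sum_part :: "nat list \<Rightarrow> symfun" where
  "power_sum_part la N = prod_list (map (\<lambda>r. power_sum r N) la)"

definition psi :: "nat list \<Rightarrow> symfun" where
  "psi \<mu> N = (\<Sum>la \<in> {la \<in> partitions (sum_list \<mu>).
                      revlex_le (replicate (sum_list \<mu>) 1) la \<and> revlex_le la \<mu>}.
               power_sum_part la N)"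

definition cells :: "nat list \<Rightarrow> (nat \<times> nat) set" where
  "cells la = {(i, j). i < length la \<and> j < la ! i}"

definition ssyt :: "nat list \<Rightarrow> nat \<Rightarrow> (nat \<times> nat \<Rightarrow> nat) set" where
  "ssyt la N = {T. (\<forall>c. c \<notin> cells la \<longrightarrow> T c = 0)
      \<and> (\<forall>c\<in>cells la. T c < N)
      \<and> (\<forall>i j. (i, j) \<in> cells la \<longrightarrow> (i, Suc j) \<in> cells la \<longrightarrow> T (i, j) \<le> T (i, Suc j))
      \<and> (\<forall>i j. (i, j) \<in> cells la \<longrightarrow> (Suc i, j) \<in> cells la \<longrightarrow> T (i, j) < T (Suc i, j))}"

definition tableau_monomial :: "nat list \<Rightarrow> (nat \<times> nat \<Rightarrow> nat) \<Rightarrow> (nat \<Rightarrow>\<^sub>0 nat)" where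
  "tableau_monomial la T = (\<Sum>c\<in>cells la. Poly_Mapping.single (T c) 1)"

definition schur :: "nat list \<Rightarrow> symfun" where
  "schur la N = (\<Sum>T\<in>ssyt la N. Poly_Mapping.single (tableau_monomial la T) 1)"

definition schur_positive :: "symfun \<Rightarrow> bool" where
  "schur_positive f \<longleftrightarrow> (\<exists>S (c :: nat list \<Rightarrow> nat). finite S \<and> (\<forall>\<nu>\<in>S. is_partition \<nu>) \<and>
      (\<forall>N. f N = (\<Sum>\<nu>\<in>S. of_nat (c \<nu>) * schur \<nu> N)))"

end

theory Submission
  imports Defs "Jordan_Normal_Form.Determinant" "HOL-Library.FuncSet"
begin

text \<open>Write \<open>h = h\<^sub>2\<close> and \<open>e = e\<^sub>2\<close>, so that \<open>p\<^sub>1\<^sup>2 = h + e\<close> and \<open>p\<^sub>2 = h - e\<close>. The sum of \<open>p\<^sub>2\<^sup>i p\<^sub>1\<^sup>2\<^sup>(\<^sup>k\<^sup>-\<^sup>i\<^sup>)\<close>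
  over \<open>i \<le> k\<close> is \<open>((h + e)\<^sup>k\<^sup>+\<^sup>1 - (h - e)\<^sup>k\<^sup>+\<^sup>1) / 2e\<close>, a polynomial in \<open>h\<close> and \<open>e\<close> with nonnegative
  coefficients, and multiplication by \<open>p\<^sub>1\<close>, \<open>h\<close> and \<open>e\<close> preserves Schur positivity by the Pieri rules.
  For the partition with first part 3 one uses in addition that
  \<open>p\<^sub>3 p\<^sub>1 + h\<^sup>2 = 2 s\<^sub>4 + s\<^sub>3\<^sub>1 + s\<^sub>1\<^sub>1\<^sub>1\<^sub>1\<close> and \<open>h\<^sup>2 - he + e\<^sup>2 = s\<^sub>4 + 2 s\<^sub>2\<^sub>2 + s\<^sub>1\<^sub>1\<^sub>1\<^sub>1\<close>.
  All multiplication rules come from alternants: \<open>p\<^sub>r a\<^sub>\<beta>\<close> is the sum of the alternants obtained by adding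
  \<open>r\<close> to one exponent, and the tableau definition of \<open>s\<^sub>\<lambda>\<close> is matched with the quotient of alternants by
  removing the last variable, where both sides branch over the shapes interlacing \<open>\<lambda>\<close>.\<close>

section \<open>Alternants\<close>

definition alternant :: "(nat \<Rightarrow> 'a::comm_ring_1) \<Rightarrow> nat \<Rightarrow> (nat \<Rightarrow> nat) \<Rightarrow> 'a" where
  "alternant x N \<alpha> = det (mat N N (\<lambda>(i, j). x j ^ (\<alpha> i + (N - 1 - i))))"

lemma alternant_leibniz:
  "alternant x N \<alpha> = (\<Sum>p | p permutes {0..<N}.
     signof p * (\<Prod>i = 0..<N. x (p i) ^ (\<alpha> i + (N - 1 - i))))"
  unfolding alternant_def
  by (subst det_def'[of _ N]) (auto intro!: sum.cong prod.cong simp: permutes_in_image)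

lemma alternant_cong:
  assumes "\<And>i. i < N \<Longrightarrow> \<alpha> i = \<beta> i"
  shows "alternant x N \<alpha> = alternant x N \<beta>"
  unfolding alternant_def by (rule arg_cong[of _ _ det], rule cong_mat) (use assms in auto)

text \<open>In the Leibniz term of \<open>p\<close> the symmetric factor may be summed as
  \<open>x (p k) ^ r\<close> over \<open>k\<close>, and the summand for \<open>k\<close> raises
  exactly the exponent of row \<open>k\<close>.\<close>

lemma power_sum_times_alternant:
  "(\<Sum>i<N. x i ^ r) * alternant x N \<alpha> = (\<Sum>k<N. alternant x N (\<alpha>(k := \<alpha> k + r)))"
proof -
  let ?P = "{p. p permutes {0..<N}}"
  let ?t = "\<lambda>p i. x (p i) ^ (\<alpha> i + (N - 1 - i))"
  have step: "(\<Prod>i = 0..<N. x (p i) ^ ((\<alpha>(k := \<alpha> k + r)) i + (N - 1 - i)))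
      = x (p k) ^ r * (\<Prod>i = 0..<N. ?t p i)" if "k < N" for p k
  proof -
    have "(\<Prod>i = 0..<N. x (p i) ^ ((\<alpha>(k := \<alpha> k + r)) i + (N - 1 - i)))
        = (\<Prod>i = 0..<N. (if i = k then x (p k) ^ r else 1) * ?t p i)"
      by (rule prod.cong) (auto simp: power_add[symmetric] add.commute add.left_commute)
    also have "\<dots> = x (p k) ^ r * (\<Prod>i = 0..<N. ?t p i)"
      using that by (subst prod.distrib) (simp add: prod.delta)
    finally show ?thesis .
  qed
  have "(\<Sum>k<N. alternant x N (\<alpha>(k := \<alpha> k + r)))
      = (\<Sum>k<N. \<Sum>p\<in>?P. signof p * (x (p k) ^ r * (\<Prod>i = 0..<N. ?t p i)))"
    unfolding alternant_leibniz using step by (intro sum.cong) auto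
  also have "\<dots> = (\<Sum>p\<in>?P. \<Sum>k<N. signof p * (x (p k) ^ r * (\<Prod>i = 0..<N. ?t p i)))"
    by (rule sum.swap)
  also have "\<dots> = (\<Sum>p\<in>?P. (\<Sum>i<N. x i ^ r) * (signof p * (\<Prod>i = 0..<N. ?t p i)))"
  proof (rule sum.cong[OF refl])
    fix p assume "p \<in> ?P"
    then have p: "p permutes {..<N}" by (simp add: atLeast0LessThan)
    have "(\<Sum>i<N. x i ^ r) = (\<Sum>k<N. x (p k) ^ r)"
      by (subst sum.permute[OF p]) (simp add: comp_def)
    then show "(\<Sum>k<N. signof p * (x (p k) ^ r * (\<Prod>i = 0..<N. ?t p i)))
        = (\<Sum>i<N. x i ^ r) * (signof p * (\<Prod>i = 0..<N. ?t p i))"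
      by (simp add: sum_distrib_right sum_distrib_left mult_ac)
  qed
  also have "\<dots> = (\<Sum>i<N. x i ^ r) * alternant x N \<alpha>"
    unfolding alternant_leibniz by (simp add: sum_distrib_left)
  finally show ?thesis by simp
qed

text \<open>Rows \<open>i\<close> and \<open>j\<close> then have the same shifted exponent.\<close>

lemma alternant_eq_0:
  assumes "i < j" "j < N" "\<alpha> j = \<alpha> i + (j - i)"
  shows "alternant x N \<alpha> = 0"
  unfolding alternant_def
  by (rule det_identical_rows[of _ N i j]) (use assms in \<open>auto intro!: eq_vecI\<close>)

text \<open>The new sequence exchanges the shifted exponents of two adjacent rows. Positivity of
  \<open>\<alpha> (Suc i)\<close> keeps the truncated subtraction exact.\<close>

lemma alternant_swap:
  assumes "Suc i < N" "0 < \<alpha> (Suc i)"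
  shows "alternant x N (\<alpha>(i := \<alpha> (Suc i) - 1, Suc i := Suc (\<alpha> i))) = - alternant x N \<alpha>"
proof -
  let ?M = "\<lambda>\<alpha>. mat N N (\<lambda>(i, j). x j ^ (\<alpha> i + (N - 1 - i)))"
  have "?M (\<alpha>(i := \<alpha> (Suc i) - 1, Suc i := Suc (\<alpha> i))) = swaprows i (Suc i) (?M \<alpha>)"
    using assms by (intro eq_matI) (auto simp: mat_swaprows_def intro!: arg_cong[of _ _ "(^) _"])
  moreover have "det (swaprows i (Suc i) (?M \<alpha>)) = - det (?M \<alpha>)"
    using assms by (intro det_swaprows[of _ N]) auto
  ultimately show ?thesis unfolding alternant_def by simp
qed

text \<open>A geometric sum. Its index runs from \<open>b\<close> to \<open>a\<close> so that in
  \<open>alternant_Suc\<close> it can serve as a row length of an interlacing shape.\<close>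

lemma power_diff_shifted:
  fixes x y :: "'a::comm_ring_1"
  assumes "b \<le> a"
  shows "x ^ (Suc a + c) - y ^ Suc (a - b) * x ^ (b + c)
    = (x - y) * (\<Sum>m\<in>{b..a}. y ^ (a - m) * x ^ (m + c))"
proof -
  have "(\<Sum>m\<in>{b..a}. y ^ (a - m) * x ^ (m + c))
      = (\<Sum>k<Suc (a - b). y ^ (Suc (a - b) - Suc k) * x ^ k) * x ^ (b + c)"
    unfolding sum_distrib_right
    by (rule sum.reindex_bij_witness[of _ "\<lambda>k. k + b" "\<lambda>m. m - b"])
      (use assms in \<open>auto simp: power_add[symmetric] mult.assoc\<close>)
  moreover have "(x - y) * (\<Sum>k<Suc (a - b). y ^ (Suc (a - b) - Suc k) * x ^ k)
      = x ^ Suc (a - b) - y ^ Suc (a - b)"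
    by (rule power_diff_sumr2[symmetric])
  moreover have "x ^ (Suc a + c) = x ^ Suc (a - b) * x ^ (b + c)"
    using assms by (simp only: power_add[symmetric]) simp
  ultimately show ?thesis
    by (simp only: mult.assoc[symmetric]) (simp add: algebra_simps)
qed

text \<open>Subtracting from each row the multiple of the next row that cancels its entry in column
  \<open>N\<close> leaves a factor \<open>x j - x N\<close> in column \<open>j\<close> of the first
  \<open>N\<close> rows. Expansion along column \<open>N\<close> removes the last variable, and
  multilinearity in the rows turns the geometric sums into a sum over interlacing sequences.\<close>

lemma alternant_Suc:
  fixes x :: "nat \<Rightarrow> 'a::comm_ring_1"
  assumes anti: "antimono \<alpha>"
  shows "alternant x (Suc N) \<alpha> = (\<Prod>j<N. x j - x N) *
    (\<Sum>\<mu>\<in>PiE {0..<N} (\<lambda>i. {\<alpha> (Suc i)..\<alpha> i}).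
       x N ^ (\<alpha> N + (\<Sum>i<N. \<alpha> i - \<mu> i)) * alternant x N \<mu>)"
proof -
  define b where "b i = \<alpha> i + (N - i)" for i
  define M where "M = mat (Suc N) (Suc N) (\<lambda>(i, j). x j ^ b i)"
  define U where "U = mat (Suc N) (Suc N) (\<lambda>(i, k). if k = i then 1 else
     if k = Suc i then - (x N ^ Suc (\<alpha> i - \<alpha> (Suc i))) else 0)"
  define q where "q i j = (\<Sum>m\<in>{\<alpha> (Suc i)..\<alpha> i}. x N ^ (\<alpha> i - m) * x j ^ (m + (N - 1 - i)))" for i j
  define D where "D = mat N N (\<lambda>(i, j). if i = j then x j - x N else 0)"
  define Q where "Q = mat N N (\<lambda>(i, j). q i j)"
  have carr: "M \<in> carrier_mat (Suc N) (Suc N)" "U \<in> carrier_mat (Suc N) (Suc N)"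
    "D \<in> carrier_mat N N" "Q \<in> carrier_mat N N"
    by (auto simp: M_def U_def D_def Q_def)
  have le: "\<alpha> (Suc i) \<le> \<alpha> i" for i using anti by (simp add: antimono_def)
  have detU: "det U = 1"
    by (subst det_upper_triangular[of _ "Suc N"])
      (auto simp: U_def upper_triangular_def prod_list_diag_prod)
  have detD: "det D = (\<Prod>j<N. x j - x N)"
    by (subst det_upper_triangular[of _ N])
      (auto simp: D_def upper_triangular_def prod_list_diag_prod atLeast0LessThan)
  have UM_last: "(U * M) $$ (N, j) = x j ^ b N" if "j < Suc N" for j
  proof -
    have "(U * M) $$ (N, j) = (\<Sum>k\<in>{0..<Suc N}. U $$ (N, k) * M $$ (k, j))"
      using that carr by (simp add: scalar_prod_def)
    also have "\<dots> = (\<Sum>k\<in>{0..<Suc N}. if k = N then x j ^ b N else 0)"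
      by (rule sum.cong) (use that in \<open>auto simp: U_def M_def\<close>)
    finally show ?thesis by simp
  qed
  have UM: "(U * M) $$ (i, j) = (x j - x N) * q i j" if "i < N" "j < Suc N" for i j
  proof -
    have "(U * M) $$ (i, j) = (\<Sum>k\<in>{0..<Suc N}. U $$ (i, k) * M $$ (k, j))"
      using that carr by (simp add: scalar_prod_def)
    also have "\<dots> = (\<Sum>k\<in>{0..<Suc N}. (if k = i then x j ^ b i else 0) +
        (if k = Suc i then - (x N ^ Suc (\<alpha> i - \<alpha> (Suc i)) * x j ^ b (Suc i)) else 0))"
      by (rule sum.cong) (use that in \<open>auto simp: U_def M_def\<close>)
    also have "\<dots> = x j ^ b i - x N ^ Suc (\<alpha> i - \<alpha> (Suc i)) * x j ^ b (Suc i)"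
      using that by (subst sum.distrib) (simp add: sum.delta)
    also have "\<dots> = x j ^ (Suc (\<alpha> i) + (N - 1 - i))
        - x N ^ Suc (\<alpha> i - \<alpha> (Suc i)) * x j ^ (\<alpha> (Suc i) + (N - 1 - i))"
    proof -
      have "b i = Suc (\<alpha> i) + (N - 1 - i)" "b (Suc i) = \<alpha> (Suc i) + (N - 1 - i)"
        using that by (auto simp: b_def)
      then show ?thesis by simp
    qed
    also have "\<dots> = (x j - x N) * q i j"
      unfolding q_def by (rule power_diff_shifted[OF le])
    finally show ?thesis .
  qed
  have "alternant x (Suc N) \<alpha> = det M"
    unfolding alternant_def M_def b_def by (rule arg_cong[of _ _ det], rule cong_mat) auto
  also have "\<dots> = det (U * M)" using det_mult[OF carr(2,1)] detU by simp
  also have "\<dots> = (\<Sum>i<Suc N. (U * M) $$ (i, N) * cofactor (U * M) i N)"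
    by (rule laplace_expansion_column) (use carr in auto)
  also have "\<dots> = x N ^ \<alpha> N * cofactor (U * M) N N"
    using UM_last[of N] by (simp add: UM b_def)
  also have "cofactor (U * M) N N = det (Q * D)"
  proof -
    have "mat_delete (U * M) N N = Q * D"
    proof (rule eq_matI)
      fix i j assume ij: "i < dim_row (Q * D)" "j < dim_col (Q * D)"
      then have ij: "i < N" "j < N" using carr by auto
      have "(Q * D) $$ (i, j) = (\<Sum>k\<in>{0..<N}. Q $$ (i, k) * D $$ (k, j))"
        using ij carr by (simp add: scalar_prod_def)
      also have "\<dots> = (\<Sum>k\<in>{0..<N}. if k = j then q i j * (x j - x N) else 0)"
        by (rule sum.cong) (use ij in \<open>auto simp: Q_def D_def\<close>)
      also have "\<dots> = (x j - x N) * q i j" using ij by simp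
      also have "\<dots> = mat_delete (U * M) N N $$ (i, j)"
        using ij carr UM[of i j] by (simp add: mat_delete_def)
      finally show "mat_delete (U * M) N N $$ (i, j) = (Q * D) $$ (i, j)" by simp
    qed (use carr in \<open>auto simp: mat_delete_def\<close>)
    then show ?thesis by (simp add: cofactor_def)
  qed
  also have "det (Q * D) = det Q * (\<Prod>j<N. x j - x N)"
    using det_mult[OF carr(4,3)] detD by simp
  also have "det Q = (\<Sum>\<mu>\<in>PiE {0..<N} (\<lambda>i. {\<alpha> (Suc i)..\<alpha> i}).
       x N ^ (\<Sum>i<N. \<alpha> i - \<mu> i) * alternant x N \<mu>)"
  proof -
    let ?B = "PiE {0..<N} (\<lambda>i. {\<alpha> (Suc i)..\<alpha> i})"
    have "det Q = (\<Sum>p | p permutes {0..<N}. signof p * (\<Prod>i = 0..<N. q i (p i)))"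
      unfolding Q_def by (subst det_def'[of _ N]) (auto intro!: sum.cong prod.cong)
    \<comment> \<open>Multiplying out the product picks one exponent \<open>\<mu> i\<close> per row,
      that is, a choice function in \<open>?B\<close>.\<close>
    also have "\<dots> = (\<Sum>p | p permutes {0..<N}. \<Sum>\<mu>\<in>?B. signof p *
        (\<Prod>i = 0..<N. x N ^ (\<alpha> i - \<mu> i) * x (p i) ^ (\<mu> i + (N - 1 - i))))"
      unfolding q_def by (subst prod_sum_PiE) (auto simp: sum_distrib_left)
    also have "\<dots> = (\<Sum>\<mu>\<in>?B. \<Sum>p | p permutes {0..<N}. signof p *
        (\<Prod>i = 0..<N. x N ^ (\<alpha> i - \<mu> i) * x (p i) ^ (\<mu> i + (N - 1 - i))))"
      by (rule sum.swap)
    also have "\<dots> = (\<Sum>\<mu>\<in>?B. x N ^ (\<Sum>i<N. \<alpha> i - \<mu> i) * alternant x N \<mu>)"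
      unfolding alternant_leibniz
      by (intro sum.cong refl)
        (simp add: sum_distrib_left prod.distrib power_sum[symmetric] atLeast0LessThan algebra_simps)
    finally show ?thesis .
  qed
  finally show ?thesis
    by (simp add: sum_distrib_left sum_distrib_right power_add algebra_simps)
qed

section \<open>Tableaux and the bialternant formula\<close>

text \<open>Shapes are functions on all row indices, in use zero from some row on, so that
  interlacing needs no bookkeeping of list lengths.\<close>

definition diagram :: "(nat \<Rightarrow> nat) \<Rightarrow> (nat \<times> nat) set" where
  "diagram \<alpha> = {(i, j). j < \<alpha> i}"

definition tableaux :: "(nat \<Rightarrow> nat) \<Rightarrow> nat \<Rightarrow> (nat \<times> nat \<Rightarrow> nat) set" where
  "tableaux \<alpha> N = {T. (\<forall>i j. \<alpha> i \<le> j \<longrightarrow> T (i, j) = 0)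
      \<and> (\<forall>i j. j < \<alpha> i \<longrightarrow> T (i, j) < N)
      \<and> (\<forall>i j. Suc j < \<alpha> i \<longrightarrow> T (i, j) \<le> T (i, Suc j))
      \<and> (\<forall>i j. j < \<alpha> (Suc i) \<longrightarrow> T (i, j) < T (Suc i, j))}"

definition tableau_sum :: "(nat \<Rightarrow> 'a::comm_ring_1) \<Rightarrow> (nat \<Rightarrow> nat) \<Rightarrow> nat \<Rightarrow> 'a" where
  "tableau_sum x \<alpha> N = (\<Sum>T\<in>tableaux \<alpha> N. \<Prod>c\<in>diagram \<alpha>. x (T c))"

text \<open>For weakly decreasing \<open>\<alpha>\<close> these are the shapes left after removing a
  horizontal strip, that is, at most one cell from each column.\<close>

definition interlacing :: "(nat \<Rightarrow> nat) \<Rightarrow> (nat \<Rightarrow> nat) set" where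
  "interlacing \<alpha> = {\<mu>. \<forall>i. \<alpha> (Suc i) \<le> \<mu> i \<and> \<mu> i \<le> \<alpha> i}"

lemma diagram_Sigma:
  assumes "\<forall>i\<ge>L. \<alpha> i = 0"
  shows "diagram \<alpha> = (SIGMA i:{..<L}. {..<\<alpha> i})"
  using assms by (auto simp: diagram_def) (metis not_less less_nat_zero_code)

lemma finite_diagram:
  assumes "\<forall>i\<ge>L. \<alpha> i = 0"
  shows "finite (diagram \<alpha>)"
  using diagram_Sigma[OF assms] by simp

lemma finite_tableaux:
  assumes "\<forall>i\<ge>L. \<alpha> i = 0"
  shows "finite (tableaux \<alpha> N)"
proof (rule finite_subset)
  show "tableaux \<alpha> N \<subseteq> {T. \<forall>c. (c \<in> diagram \<alpha> \<longrightarrow> T c \<in> {..<N}) \<and> (c \<notin> diagram \<alpha> \<longrightarrow> T c = 0)}"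
    by (auto simp: tableaux_def diagram_def)
  show "finite {T. \<forall>c. (c \<in> diagram \<alpha> \<longrightarrow> T c \<in> {..<N}) \<and> (c \<notin> diagram \<alpha> \<longrightarrow> T c = 0)}"
    using finite_diagram[OF assms] by (intro finite_set_of_finite_funs) auto
qed

lemma finite_interlacing:
  assumes "\<forall>i\<ge>L. \<alpha> i = 0"
  shows "finite (interlacing \<alpha>)"
proof (rule finite_subset)
  let ?B = "{..Max (\<alpha> ` {..<L})}"
  show "interlacing \<alpha> \<subseteq> {\<mu>. \<forall>i. (i \<in> {..<L} \<longrightarrow> \<mu> i \<in> ?B) \<and> (i \<notin> {..<L} \<longrightarrow> \<mu> i = 0)}"
  proof (rule subsetI, rule CollectI, intro allI conjI impI)
    fix \<mu> i assume \<mu>: "\<mu> \<in> interlacing \<alpha>"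
    then have le: "\<mu> i \<le> \<alpha> i" by (simp add: interlacing_def)
    show "\<mu> i \<in> ?B" if "i \<in> {..<L}"
      using le that by (auto intro: order.trans[OF _ Max_ge])
    show "\<mu> i = 0" if "i \<notin> {..<L}"
      using le that assms by simp
  qed
  show "finite {\<mu>. \<forall>i. (i \<in> {..<L} \<longrightarrow> \<mu> i \<in> ?B) \<and> (i \<notin> {..<L} \<longrightarrow> \<mu> i = 0)}"
    by (intro finite_set_of_finite_funs) auto
qed

lemma interlacing_antimono:
  assumes "\<mu> \<in> interlacing \<alpha>"
  shows "antimono \<mu>"
  unfolding decseq_Suc_iff
  using assms by (auto simp: interlacing_def intro: order.trans)

text \<open>For a tableau with entries at most \<open>N\<close>, this is the shape that remains when
  the cells with entry \<open>N\<close> are deleted.\<close>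

definition inner_shape :: "(nat \<Rightarrow> nat) \<Rightarrow> nat \<Rightarrow> (nat \<times> nat \<Rightarrow> nat) \<Rightarrow> nat \<Rightarrow> nat" where
  "inner_shape \<alpha> N T i = card {j. j < \<alpha> i \<and> T (i, j) < N}"

lemma tableaux_row_mono:
  assumes "T \<in> tableaux \<alpha> N" "j \<le> k" "k < \<alpha> i"
  shows "T (i, j) \<le> T (i, k)"
  using assms(2,3)
proof (induction k rule: dec_induct)
  case (step k)
  then show ?case using assms(1) by (force simp: tableaux_def)
qed simp

text \<open>Rows increase weakly, so the positions with entry below \<open>N\<close> are closed
  downwards and form an initial segment, which is determined by its size.\<close>

lemma inner_shape_iff:
  assumes T: "T \<in> tableaux \<alpha> (Suc N)"
  shows "j < inner_shape \<alpha> N T i \<longleftrightarrow> j < \<alpha> i \<and> T (i, j) < N"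
proof -
  let ?S = "{j. j < \<alpha> i \<and> T (i, j) < N}"
  have down: "k \<in> ?S" if "j \<in> ?S" "k \<le> j" for j k
    using that tableaux_row_mono[OF T that(2), of i] by auto
  have "?S = {..<card ?S}"
  proof (rule card_subset_eq[symmetric])
    show "{..<card ?S} \<subseteq> ?S"
    proof
      fix k assume k: "k \<in> {..<card ?S}"
      show "k \<in> ?S"
      proof (rule ccontr)
        assume "k \<notin> ?S"
        then have "?S \<subseteq> {..<k}" using down by (meson lessThan_iff not_le subsetI)
        then have "card ?S \<le> k" using card_mono[of "{..<k}" ?S] by simp
        then show False using k by simp
      qed
    qed
  qed auto
  then show ?thesis unfolding inner_shape_def by (metis (no_types, lifting) lessThan_iff mem_Collect_eq)
qed

text \<open>The lower bound is column strictness: a cell directly above another one has an entry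
  smaller than some entry at most \<open>N\<close>.\<close>

lemma inner_shape_interlacing:
  assumes T: "T \<in> tableaux \<alpha> (Suc N)" and anti: "antimono \<alpha>"
  shows "inner_shape \<alpha> N T \<in> interlacing \<alpha>"
  unfolding interlacing_def
proof (rule CollectI, intro allI conjI)
  fix i
  have "j < inner_shape \<alpha> N T i" if j: "j < \<alpha> (Suc i)" for j
  proof -
    have "T (i, j) < T (Suc i, j)" "T (Suc i, j) < Suc N"
      using T j by (auto simp: tableaux_def)
    moreover have "j < \<alpha> i" using j antimonoD[OF anti, of i "Suc i"] by simp
    ultimately show ?thesis by (simp add: inner_shape_iff[OF T])
  qed
  then show "\<alpha> (Suc i) \<le> inner_shape \<alpha> N T i" by (meson not_less order_refl)
  show "inner_shape \<alpha> N T i \<le> \<alpha> i"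
    using inner_shape_iff[OF T, of "\<alpha> i" i] by simp
qed

text \<open>A tableau with entries at most \<open>N\<close> amounts to a horizontal strip filled
  with \<open>N\<close> and a tableau with smaller entries on the remaining shape.\<close>

lemma tableau_sum_Suc:
  fixes x :: "nat \<Rightarrow> 'a::comm_ring_1"
  assumes anti: "antimono \<alpha>" and supp: "\<forall>i\<ge>L. \<alpha> i = 0"
  shows "tableau_sum x \<alpha> (Suc N)
    = (\<Sum>\<mu>\<in>interlacing \<alpha>. x N ^ card (diagram \<alpha> - diagram \<mu>) * tableau_sum x \<mu> N)"
proof -
  \<comment> \<open>The two directions of the bijection. Resetting to 0 outside the diagram follows
    the convention in \<open>tableaux\<close> that makes a filling a unique function.\<close>
  let ?inner = "\<lambda>T. (inner_shape \<alpha> N T, \<lambda>c. if c \<in> diagram (inner_shape \<alpha> N T) then T c else 0)"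
  let ?extend = "\<lambda>(\<mu>, T). \<lambda>c. if c \<in> diagram \<mu> then T c else if c \<in> diagram \<alpha> then N else 0"
  have suppI: "\<forall>i\<ge>L. \<mu> i = 0" if "\<mu> \<in> interlacing \<alpha>" for \<mu>
    using that supp by (simp add: interlacing_def) (metis le_zero_eq)
  have "tableau_sum x \<alpha> (Suc N) = (\<Sum>(\<mu>, T)\<in>(SIGMA \<mu>:interlacing \<alpha>. tableaux \<mu> N).
      x N ^ card (diagram \<alpha> - diagram \<mu>) * (\<Prod>c\<in>diagram \<mu>. x (T c)))"
    unfolding tableau_sum_def
  proof (rule sum.reindex_bij_witness[of _ ?extend ?inner])
    fix T assume T: "T \<in> tableaux \<alpha> (Suc N)"
    note iff = inner_shape_iff[OF T]
    have ge: "T (i, j) = N" if "j < \<alpha> i" "\<not> j < inner_shape \<alpha> N T i" for i j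
    proof -
      have "T (i, j) < Suc N" using T that(1) by (simp add: tableaux_def)
      then show ?thesis using that iff[of j i] by simp
    qed
    have sub: "diagram (inner_shape \<alpha> N T) \<subseteq> diagram \<alpha>"
      by (auto simp: diagram_def iff)
    show "?extend (?inner T) = T"
    proof (rule ext)
      fix c show "?extend (?inner T) c = T c"
        using T ge sub by (cases c) (auto simp: diagram_def tableaux_def not_less)
    qed
    show "?inner T \<in> (SIGMA \<mu>:interlacing \<alpha>. tableaux \<mu> N)"
    proof -
      have "(\<lambda>c. if c \<in> diagram (inner_shape \<alpha> N T) then T c else 0) \<in> tableaux (inner_shape \<alpha> N T) N"
        unfolding tableaux_def
      proof (rule CollectI, intro conjI allI impI)
        fix i j
        show "(if (i, j) \<in> diagram (inner_shape \<alpha> N T) then T (i, j) else 0)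
            < (if (Suc i, j) \<in> diagram (inner_shape \<alpha> N T) then T (Suc i, j) else 0)"
          if j: "j < inner_shape \<alpha> N T (Suc i)"
        proof -
          have "T (i, j) < T (Suc i, j)" using j T by (simp add: iff) (simp add: tableaux_def)
          then show ?thesis using j by (auto simp: diagram_def)
        qed
        show "(if (i, j) \<in> diagram (inner_shape \<alpha> N T) then T (i, j) else 0)
            \<le> (if (i, Suc j) \<in> diagram (inner_shape \<alpha> N T) then T (i, Suc j) else 0)"
          if "Suc j < inner_shape \<alpha> N T i"
          using that tableaux_row_mono[OF T, of j "Suc j" i] iff[of "Suc j" i] by (simp add: diagram_def)
        show "(if (i, j) \<in> diagram (inner_shape \<alpha> N T) then T (i, j) else 0) = 0"
          if "inner_shape \<alpha> N T i \<le> j"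
          using that by (simp add: diagram_def)
        show "(if (i, j) \<in> diagram (inner_shape \<alpha> N T) then T (i, j) else 0) < N"
          if "j < inner_shape \<alpha> N T i"
          using that iff[of j i] by (simp add: diagram_def)
      qed
      then show ?thesis using inner_shape_interlacing[OF T anti] by simp
    qed
    have "(\<Prod>c\<in>diagram \<alpha>. x (T c)) = (\<Prod>c\<in>diagram \<alpha> - diagram (inner_shape \<alpha> N T). x (T c))
        * (\<Prod>c\<in>diagram (inner_shape \<alpha> N T). x (T c))"
      by (rule prod.subset_diff[OF sub finite_diagram[OF supp]])
    also have "(\<Prod>c\<in>diagram \<alpha> - diagram (inner_shape \<alpha> N T). x (T c))
        = (\<Prod>c\<in>diagram \<alpha> - diagram (inner_shape \<alpha> N T). x N)"
      by (rule prod.cong) (use ge in \<open>auto simp: diagram_def\<close>)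
    finally show "(case ?inner T of (\<mu>, T) \<Rightarrow>
        x N ^ card (diagram \<alpha> - diagram \<mu>) * (\<Prod>c\<in>diagram \<mu>. x (T c))) = (\<Prod>c\<in>diagram \<alpha>. x (T c))"
      by simp
  next
    fix p assume "p \<in> (SIGMA \<mu>:interlacing \<alpha>. tableaux \<mu> N)"
    then obtain \<mu> T where p: "p = (\<mu>, T)" and \<mu>: "\<mu> \<in> interlacing \<alpha>" and T: "T \<in> tableaux \<mu> N"
      by auto
    have lo: "\<alpha> (Suc i) \<le> \<mu> i" and hi: "\<mu> i \<le> \<alpha> i" for i
      using \<mu> by (auto simp: interlacing_def)
    have T0: "\<mu> i \<le> j \<Longrightarrow> T (i, j) = 0" and TN: "j < \<mu> i \<Longrightarrow> T (i, j) < N"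
      and Tr: "Suc j < \<mu> i \<Longrightarrow> T (i, j) \<le> T (i, Suc j)"
      and Tc: "j < \<mu> (Suc i) \<Longrightarrow> T (i, j) < T (Suc i, j)" for i j
      using T by (auto simp: tableaux_def)
    have ext_eq: "?extend p (i, j) = (if j < \<mu> i then T (i, j) else if j < \<alpha> i then N else 0)" for i j
      by (simp add: p diagram_def)
    show extp: "?extend p \<in> tableaux \<alpha> (Suc N)"
      unfolding tableaux_def
    proof (rule CollectI, intro conjI allI impI)
      fix i j
      show "?extend p (i, j) = 0" if "\<alpha> i \<le> j" using that hi[of i] by (simp add: ext_eq)
      show "?extend p (i, j) < Suc N" if "j < \<alpha> i" using that TN[of j i] by (auto simp: ext_eq)
      show "?extend p (i, j) \<le> ?extend p (i, Suc j)" if "Suc j < \<alpha> i"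
        using that TN[of j i] Tr[of j i] by (auto simp: ext_eq)
      \<comment> \<open>By interlacing, the upper cell already lies in \<open>\<mu>\<close>, so its
        entry is below \<open>N\<close>.\<close>
      show "?extend p (i, j) < ?extend p (Suc i, j)" if "j < \<alpha> (Suc i)"
        using that TN[of j i] Tc[of j i] lo[of i] by (auto simp: ext_eq)
    qed
    have "inner_shape \<alpha> N (?extend p) i = \<mu> i" for i
    proof -
      have "j < inner_shape \<alpha> N (?extend p) i \<longleftrightarrow> j < \<mu> i" for j
        using hi[of i] TN[of j i] unfolding inner_shape_iff[OF extp] ext_eq by auto
      then show ?thesis by (meson linorder_neqE_nat less_irrefl)
    qed
    then have sh: "inner_shape \<alpha> N (?extend p) = \<mu>" by (rule ext)
    have "(\<lambda>c. if c \<in> diagram \<mu> then ?extend p c else 0) = T"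
      using T0 by (auto simp: fun_eq_iff p diagram_def not_less)
    then show "?inner (?extend p) = p" unfolding sh using p by simp
  qed
  also have "\<dots> = (\<Sum>\<mu>\<in>interlacing \<alpha>. \<Sum>T\<in>tableaux \<mu> N.
      x N ^ card (diagram \<alpha> - diagram \<mu>) * (\<Prod>c\<in>diagram \<mu>. x (T c)))"
    by (rule sum.Sigma[symmetric])
      (use finite_interlacing[OF supp] finite_tableaux[OF suppI] in auto)
  finally show ?thesis unfolding tableau_sum_def by (simp add: sum_distrib_left)
qed

text \<open>Strict increase down the first column forces an entry at least \<open>N\<close> in row
  \<open>N\<close>, so there is no tableau with more than \<open>N\<close> rows.\<close>

lemma tableau_sum_eq_0:
  assumes anti: "antimono \<alpha>" and pos: "0 < \<alpha> N"
  shows "tableau_sum x \<alpha> N = 0"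
proof -
  have False if T: "T \<in> tableaux \<alpha> N" for T
  proof -
    have pos': "0 < \<alpha> i" if "i \<le> N" for i
      using antimonoD[OF anti that] pos by simp
    have "i \<le> T (i, 0)" if "i \<le> N" for i
      using that
    proof (induction i)
      case (Suc i)
      then have "T (i, 0) < T (Suc i, 0)" using T pos'[of "Suc i"] by (auto simp: tableaux_def)
      then show ?case using Suc by simp
    qed simp
    from this[of N] have "N \<le> T (N, 0)" by simp
    moreover have "T (N, 0) < N" using T pos by (auto simp: tableaux_def)
    ultimately show False by simp
  qed
  then have "tableaux \<alpha> N = {}" by blast
  then show ?thesis by (simp add: tableau_sum_def)
qed

text \<open>Only the zero sequence interlaces the zero sequence, so the branching sum has a single
  term.\<close>

lemma alternant_Suc_0:
  "alternant x (Suc N) (\<lambda>_. 0) = (\<Prod>j<N. x j - x N) * alternant x N (\<lambda>_. 0)"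
proof -
  have "alternant x N (restrict (\<lambda>_. 0) {0..<N}) = alternant x N (\<lambda>_. 0)"
    by (rule alternant_cong) simp
  moreover have "PiE {0..<N} (\<lambda>i. {0..0::nat}) = {restrict (\<lambda>_. 0) {0..<N}}"
    by (auto simp: PiE_iff fun_eq_iff extensional_def)
  ultimately show ?thesis
    by (subst alternant_Suc) (auto simp: antimono_def)
qed

text \<open>Both sides branch over the same interlacing shapes when the last variable is removed.
  The product form avoids division by the Vandermonde determinant.\<close>

theorem bialternant_formula:
  fixes x :: "nat \<Rightarrow> 'a::comm_ring_1"
  assumes "antimono \<alpha>" "\<forall>i\<ge>N. \<alpha> i = 0"
  shows "alternant x N (\<lambda>_. 0) * tableau_sum x \<alpha> N = alternant x N \<alpha>"
  using assms
proof (induction N arbitrary: \<alpha>)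
  case 0
  then have \<alpha>: "\<alpha> = (\<lambda>_. 0)" by auto
  have "tableaux \<alpha> 0 = {\<lambda>_. 0}" unfolding \<alpha> by (auto simp: tableaux_def)
  then show ?case by (simp add: tableau_sum_def \<alpha> diagram_def)
next
  case (Suc N)
  let ?B = "PiE {0..<N} (\<lambda>i. {\<alpha> (Suc i)..\<alpha> i})"
  let ?I = "{\<mu> \<in> interlacing \<alpha>. \<mu> N = 0}"
  have supp: "\<mu> i = 0" if "\<mu> \<in> interlacing \<alpha>" "Suc N \<le> i" for \<mu> i
    using that Suc.prems(2) by (simp add: interlacing_def) (metis le_zero_eq)
  have "alternant x N (\<lambda>_. 0) * tableau_sum x \<alpha> (Suc N)
      = (\<Sum>\<mu>\<in>interlacing \<alpha>. x N ^ card (diagram \<alpha> - diagram \<mu>) *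
          (alternant x N (\<lambda>_. 0) * tableau_sum x \<mu> N))"
    using tableau_sum_Suc[OF Suc.prems, of x N] by (simp add: sum_distrib_left mult_ac)
  \<comment> \<open>A shape with a nonempty row \<open>N\<close> has too many rows for a tableau in
    \<open>N\<close> variables.\<close>
  also have "\<dots> = (\<Sum>\<mu>\<in>?I. x N ^ card (diagram \<alpha> - diagram \<mu>) *
          (alternant x N (\<lambda>_. 0) * tableau_sum x \<mu> N))"
  proof (rule sum.mono_neutral_right)
    show "\<forall>\<mu>\<in>interlacing \<alpha> - ?I. x N ^ card (diagram \<alpha> - diagram \<mu>) *
          (alternant x N (\<lambda>_. 0) * tableau_sum x \<mu> N) = 0"
      using tableau_sum_eq_0[OF interlacing_antimono, of _ \<alpha> N x] by simp
  qed (use finite_interlacing[OF Suc.prems(2)] in auto)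
  \<comment> \<open>Choice functions are undefined beyond row \<open>N - 1\<close> while shapes are
    zero there; the alternant in \<open>N\<close> variables sees only the common part. Row
    \<open>N\<close> of the strip contributes the extra \<open>\<alpha> N\<close>.\<close>
  also have "\<dots> = (\<Sum>\<mu>\<in>?B. x N ^ (\<alpha> N + (\<Sum>i<N. \<alpha> i - \<mu> i)) * alternant x N \<mu>)"
  proof (rule sum.reindex_bij_witness[of _ "\<lambda>\<mu> i. if i < N then \<mu> i else 0" "\<lambda>\<mu>. restrict \<mu> {0..<N}"])
    fix \<mu> assume \<mu>: "\<mu> \<in> ?I"
    have 0: "\<mu> i = 0" if "N \<le> i" for i
      using \<mu> supp[of \<mu> i] that by (cases "i = N") auto
    show "(\<lambda>i. if i < N then restrict \<mu> {0..<N} i else 0) = \<mu>"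
      using 0 by (auto simp: fun_eq_iff)
    show "restrict \<mu> {0..<N} \<in> ?B" using \<mu> by (auto simp: interlacing_def)
    have "diagram \<alpha> - diagram \<mu> = (SIGMA i:{..<Suc N}. {\<mu> i..<\<alpha> i})"
      unfolding diagram_Sigma[OF Suc.prems(2)] by (auto simp: diagram_def)
    then have "card (diagram \<alpha> - diagram \<mu>) = (\<Sum>i<Suc N. \<alpha> i - \<mu> i)" by simp
    then have "card (diagram \<alpha> - diagram \<mu>) = \<alpha> N + (\<Sum>i<N. \<alpha> i - \<mu> i)"
      using 0[of N] by simp
    moreover have "alternant x N (restrict \<mu> {0..<N}) = alternant x N \<mu>"
      by (rule alternant_cong) simp
    moreover have "alternant x N (\<lambda>_. 0) * tableau_sum x \<mu> N = alternant x N \<mu>"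
      using \<mu> 0 by (intro Suc.IH) (auto simp: interlacing_antimono)
    ultimately show "x N ^ (\<alpha> N + (\<Sum>i<N. \<alpha> i - restrict \<mu> {0..<N} i)) * alternant x N (restrict \<mu> {0..<N})
      = x N ^ card (diagram \<alpha> - diagram \<mu>) * (alternant x N (\<lambda>_. 0) * tableau_sum x \<mu> N)"
      by simp
  next
    fix \<mu> assume \<mu>: "\<mu> \<in> ?B"
    show "restrict (\<lambda>i. if i < N then \<mu> i else 0) {0..<N} = \<mu>"
      using \<mu> by (auto simp: fun_eq_iff PiE_iff extensional_def)
    show "(\<lambda>i. if i < N then \<mu> i else 0) \<in> ?I"
      using \<mu> Suc.prems(2) by (auto simp: interlacing_def PiE_iff not_less)
  qed
  finally show ?case
    unfolding alternant_Suc_0 alternant_Suc[OF Suc.prems(1)] by (simp add: mult.assoc)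
qed

section \<open>Schur positivity via alternants\<close>

definition xvar :: "nat \<Rightarrow> ipoly" where
  "xvar i = Poly_Mapping.single (Poly_Mapping.single i 1) 1"

lemma xvar_power: "xvar i ^ r = Poly_Mapping.single (Poly_Mapping.single i r) 1"
  by (induction r) (simp_all add: xvar_def mult_single single_add[symmetric])

lemma xvar_inject: "xvar i = xvar j \<longleftrightarrow> i = j"
proof
  assume "xvar i = xvar j"
  then have "Poly_Mapping.keys (xvar i) = Poly_Mapping.keys (xvar j)" by simp
  then have "Poly_Mapping.single i (1::nat) = Poly_Mapping.single j 1" by (simp add: xvar_def)
  then have "Poly_Mapping.keys (Poly_Mapping.single i (1::nat)) = Poly_Mapping.keys (Poly_Mapping.single j (1::nat))"
    by simp
  then show "i = j" by simp
qed simp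

lemma power_sum_eq: "power_sum r N = (\<Sum>i<N. xvar i ^ r)"
  by (simp add: power_sum_def xvar_power)

definition shape :: "nat list \<Rightarrow> nat \<Rightarrow> nat" where
  "shape la i = (if i < length la then la ! i else 0)"

definition is_shape :: "(nat \<Rightarrow> nat) \<Rightarrow> bool" where
  "is_shape \<alpha> \<longleftrightarrow> antimono \<alpha> \<and> (\<exists>L. \<forall>i\<ge>L. \<alpha> i = 0)"

lemma antimono_shape:
  assumes "is_partition la"
  shows "antimono (shape la)"
  using assms unfolding is_partition_def shape_def antimono_def
  by (auto simp: sorted_wrt_iff_nth_less le_less)

lemma is_shape_shape: "is_partition la \<Longrightarrow> is_shape (shape la)"
  by (auto simp: is_shape_def antimono_shape) (auto simp: shape_def intro!: exI[of _ "length la"])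

lemma prod_single: "finite A \<Longrightarrow> (\<Prod>c\<in>A. xvar (f c)) = Poly_Mapping.single (\<Sum>c\<in>A. Poly_Mapping.single (f c) 1) 1"
  by (induction A rule: finite_induct) (simp_all add: xvar_def mult_single)

lemma schur_eq_tableau_sum:
  assumes "is_partition la"
  shows "schur la N = tableau_sum xvar (shape la) N"
proof -
  have cells: "cells la = diagram (shape la)"
    by (auto simp: cells_def diagram_def shape_def split: if_splits)
  have "shape la (Suc i) \<le> shape la i" for i
    using antimono_shape[OF assms] by (simp add: antimono_def)
  \<comment> \<open>A cell below another one in the diagram forces the upper one to be present, so
    the double membership conditions of \<open>ssyt\<close> reduce to the single ones of
    \<open>tableaux\<close>.\<close>
  then have up: "j < shape la i \<and> j < shape la (Suc i) \<longleftrightarrow> j < shape la (Suc i)" for i j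
    by (meson less_le_trans)
  have left: "j < shape la i \<and> Suc j < shape la i \<longleftrightarrow> Suc j < shape la i" for i j by auto
  have "ssyt la N = tableaux (shape la) N"
    unfolding ssyt_def tableaux_def cells diagram_def split_paired_All Ball_def mem_Collect_eq case_prod_conv
      not_less imp_conjL[symmetric] up left ..
  moreover have "finite (diagram (shape la))"
    by (rule finite_diagram[of "length la"]) (simp add: shape_def)
  ultimately show ?thesis
    unfolding schur_def tableau_sum_def tableau_monomial_def by (simp add: cells prod_single)
qed

lemma shape_exhaust:
  assumes "is_shape \<alpha>"
  obtains la where "is_partition la" "shape la = \<alpha>"
proof -
  obtain L where L: "\<forall>i\<ge>L. \<alpha> i = 0" using assms by (auto simp: is_shape_def)
  define l where "l = (LEAST k. \<alpha> k = 0)"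
  have l0: "\<alpha> l = 0" unfolding l_def by (rule LeastI[of _ L]) (use L in simp)
  have pos: "0 < \<alpha> i" if "i < l" for i
    using not_less_Least[of i "\<lambda>k. \<alpha> k = 0"] that by (simp add: l_def)
  have anti: "\<alpha> j \<le> \<alpha> i" if "i \<le> j" for i j using assms that by (auto simp: is_shape_def antimono_def)
  let ?la = "map \<alpha> [0..<l]"
  have "is_partition ?la"
    unfolding is_partition_def using pos anti by (auto simp: sorted_wrt_iff_nth_less)
  moreover have "shape ?la = \<alpha>"
    using anti[of l] l0 by (auto simp: shape_def fun_eq_iff not_less)
  ultimately show ?thesis by (rule that)
qed

section \<open>Closure properties of Schur positivity\<close>

lemma schur_positive_zero: "schur_positive (\<lambda>N. 0)"
  unfolding schur_positive_def by (intro exI[of _ "{}"]) auto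

lemma schur_positive_add:
  assumes "schur_positive f" "schur_positive g"
  shows "schur_positive (\<lambda>N. f N + g N)"
proof -
  obtain S c where S: "finite S" "\<forall>\<nu>\<in>S. is_partition \<nu>" "\<And>N. f N = (\<Sum>\<nu>\<in>S. of_nat (c \<nu>) * schur \<nu> N)"
    using assms(1) unfolding schur_positive_def by blast
  obtain S' c' where S': "finite S'" "\<forall>\<nu>\<in>S'. is_partition \<nu>" "\<And>N. g N = (\<Sum>\<nu>\<in>S'. of_nat (c' \<nu>) * schur \<nu> N)"
    using assms(2) unfolding schur_positive_def by blast
  \<comment> \<open>\<open>c\<close> and \<open>c'\<close> are arbitrary outside \<open>S\<close>
    and \<open>S'\<close>, so they are cut off before being added.\<close>
  define d where "d \<nu> = (if \<nu> \<in> S then c \<nu> else 0) + (if \<nu> \<in> S' then c' \<nu> else 0)" for \<nu>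
  have "f N = (\<Sum>\<nu>\<in>S \<union> S'. of_nat (if \<nu> \<in> S then c \<nu> else 0) * schur \<nu> N)" for N
    unfolding S by (rule sum.mono_neutral_cong_left) (use S S' in auto)
  moreover have "g N = (\<Sum>\<nu>\<in>S \<union> S'. of_nat (if \<nu> \<in> S' then c' \<nu> else 0) * schur \<nu> N)" for N
    unfolding S' by (rule sum.mono_neutral_cong_left) (use S S' in auto)
  ultimately have "f N + g N = (\<Sum>\<nu>\<in>S \<union> S'. of_nat (d \<nu>) * schur \<nu> N)" for N
    by (simp only: d_def of_nat_add distrib_right sum.distrib)
  then show ?thesis
    unfolding schur_positive_def using S S' by (intro exI[of _ "S \<union> S'"] exI[of _ d]) auto
qed

lemma schur_positive_sum:
  assumes "finite A" "\<And>a. a \<in> A \<Longrightarrow> schur_positive (f a)"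
  shows "schur_positive (\<lambda>N. \<Sum>a\<in>A. f a N)"
  using assms by (induction A rule: finite_induct) (auto intro: schur_positive_zero schur_positive_add)

lemma schur_positive_of_nat_mult:
  assumes "schur_positive f"
  shows "schur_positive (\<lambda>N. of_nat k * f N)"
  by (induction k) (auto simp: distrib_right intro: schur_positive_zero schur_positive_add assms)

lemma schur_positive_tableau_sum:
  assumes "is_shape \<alpha>"
  shows "schur_positive (tableau_sum xvar \<alpha>)"
proof -
  obtain la where la: "is_partition la" "shape la = \<alpha>" using assms by (rule shape_exhaust)
  then show ?thesis
    unfolding schur_positive_def
    by (intro exI[of _ "{la}"] exI[of _ "\<lambda>_. 1"]) (auto simp: schur_eq_tableau_sum)
qed

text \<open>This property passes to sums and products at once. With it the Pieri rules for the three
  generators \<open>p1\<close>, \<open>h2\<close> and \<open>e2\<close> suffice, and no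
  Littlewood-Richardson rule for general products enters.\<close>

definition schur_multiplier :: "symfun \<Rightarrow> bool" where
  "schur_multiplier g \<longleftrightarrow> (\<forall>f. schur_positive f \<longrightarrow> schur_positive (\<lambda>N. g N * f N))"

text \<open>By linearity it is enough to test single Schur functions.\<close>

lemma schur_multiplierI:
  assumes "\<And>\<alpha>. is_shape \<alpha> \<Longrightarrow> schur_positive (\<lambda>N. g N * tableau_sum xvar \<alpha> N)"
  shows "schur_multiplier g"
  unfolding schur_multiplier_def
proof (intro allI impI)
  fix f assume "schur_positive f"
  then obtain S c where S: "finite S" "\<forall>\<nu>\<in>S. is_partition \<nu>" "\<And>N. f N = (\<Sum>\<nu>\<in>S. of_nat (c \<nu>) * schur \<nu> N)"
    unfolding schur_positive_def by blast
  have "(\<lambda>N. g N * f N) = (\<lambda>N. \<Sum>\<nu>\<in>S. of_nat (c \<nu>) * (g N * tableau_sum xvar (shape \<nu>) N))"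
    using S by (simp add: sum_distrib_left mult.left_commute schur_eq_tableau_sum)
  moreover have "schur_positive \<dots>"
    using S assms is_shape_shape by (intro schur_positive_sum schur_positive_of_nat_mult) auto
  ultimately show "schur_positive (\<lambda>N. g N * f N)" by simp
qed

lemma schur_multiplier_mult:
  "schur_multiplier f \<Longrightarrow> schur_multiplier g \<Longrightarrow> schur_multiplier (\<lambda>N. f N * g N)"
  unfolding schur_multiplier_def by (simp add: mult.assoc)

lemma schur_multiplier_add:
  "schur_multiplier f \<Longrightarrow> schur_multiplier g \<Longrightarrow> schur_multiplier (\<lambda>N. f N + g N)"
  unfolding schur_multiplier_def by (simp add: distrib_right schur_positive_add)

lemma schur_multiplier_of_nat: "schur_multiplier (\<lambda>N. of_nat k)"
  unfolding schur_multiplier_def by (simp add: schur_positive_of_nat_mult)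

lemma schur_multiplier_power:
  "schur_multiplier f \<Longrightarrow> schur_multiplier (\<lambda>N. f N ^ k)"
  using schur_multiplier_of_nat[of 1]
  by (induction k) (auto intro: schur_multiplier_mult)

lemma schur_positive_one: "schur_positive (\<lambda>N. 1)"
proof -
  have "tableaux (\<lambda>_. 0) N = {\<lambda>_. 0}" for N by (auto simp: tableaux_def)
  then have "tableau_sum xvar (\<lambda>_. 0) = (\<lambda>N. 1)" by (simp add: tableau_sum_def diagram_def fun_eq_iff)
  moreover have "is_shape (\<lambda>_. 0)" by (simp add: is_shape_def antimono_def)
  ultimately show ?thesis using schur_positive_tableau_sum by metis
qed

lemma schur_multiplier_positive: "schur_multiplier f \<Longrightarrow> schur_positive f"
  using schur_positive_one unfolding schur_multiplier_def by force

section \<open>Reading Schur expansions off truncated alternants\<close>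

definition vandermonde :: "nat \<Rightarrow> ipoly" where
  "vandermonde N = alternant xvar N (\<lambda>_. 0)"

text \<open>The recursion multiplies by differences of distinct variables in an integral domain.
  This permits cancelling the Vandermonde factor later.\<close>

lemma vandermonde_nonzero: "vandermonde N \<noteq> 0"
proof (induction N)
  case 0
  then show ?case by (simp add: vandermonde_def alternant_def)
next
  case (Suc N)
  then show ?case by (auto simp: vandermonde_def alternant_Suc_0 xvar_inject)
qed

text \<open>Setting the alternant to zero when a part lies beyond the last variable makes all
  identities below independent of the number of variables.\<close>

definition trunc_alternant :: "nat \<Rightarrow> (nat \<Rightarrow> nat) \<Rightarrow> ipoly" where
  "trunc_alternant N \<alpha> = (if \<forall>i\<ge>N. \<alpha> i = 0 then alternant xvar N \<alpha> else 0)"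

text \<open>With at most \<open>N\<close> rows this is the bialternant formula. With more rows, the
  left side vanishes by truncation and the right side for lack of tableaux.\<close>

lemma trunc_alternant_shape:
  assumes "is_shape \<alpha>"
  shows "trunc_alternant N \<alpha> = vandermonde N * tableau_sum xvar \<alpha> N"
proof (cases "\<forall>i\<ge>N. \<alpha> i = 0")
  case True
  then show ?thesis using assms bialternant_formula[of \<alpha> N xvar]
    by (simp add: trunc_alternant_def vandermonde_def is_shape_def)
next
  case False
  then obtain i where i: "N \<le> i" "\<alpha> i \<noteq> 0" by auto
  have anti: "antimono \<alpha>" using assms by (simp add: is_shape_def)
  then have "0 < \<alpha> N" using antimonoD[OF anti i(1)] i(2) by simp
  then show ?thesis using False by (simp only: trunc_alternant_def if_False tableau_sum_eq_0[OF anti]) simp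
qed

text \<open>\<open>D\<close> and \<open>t\<close> do not depend on \<open>N\<close>, because a
  single Schur expansion must hold for all numbers of variables. Multiplicities are allowed since
  \<open>t\<close> may repeat shapes.\<close>

lemma schur_positive_from_alternants:
  assumes "finite D" "\<And>d. d \<in> D \<Longrightarrow> is_shape (t d)"
    and "\<And>N. vandermonde N * f N = (\<Sum>d\<in>D. trunc_alternant N (t d))"
  shows "schur_positive f"
proof -
  have "vandermonde N * f N = vandermonde N * (\<Sum>d\<in>D. tableau_sum xvar (t d) N)" for N
    using assms by (simp add: trunc_alternant_shape sum_distrib_left)
  then have "f = (\<lambda>N. \<Sum>d\<in>D. tableau_sum xvar (t d) N)"
    using vandermonde_nonzero by (simp add: fun_eq_iff)
  moreover have "schur_positive \<dots>"
    using assms by (intro schur_positive_sum schur_positive_tableau_sum)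
  ultimately show ?thesis by simp
qed

lemma trunc_alternant_eq_0:
  assumes "i < j" "\<alpha> j = \<alpha> i + (j - i)"
  shows "trunc_alternant N \<alpha> = 0"
proof (cases "\<forall>i\<ge>N. \<alpha> i = 0")
  case True
  moreover have "0 < \<alpha> j" using assms by simp
  ultimately have "j < N" by (metis not_le less_irrefl)
  then show ?thesis using assms by (simp add: trunc_alternant_def alternant_eq_0)
qed (simp only: trunc_alternant_def if_False)

lemma trunc_alternant_beyond: "N \<le> i \<Longrightarrow> 0 < \<alpha> i \<Longrightarrow> trunc_alternant N \<alpha> = 0"
  by (auto simp: trunc_alternant_def)

text \<open>If row \<open>Suc i\<close> lies beyond the last variable, both sequences are positive
  there and both sides vanish.\<close>

lemma trunc_alternant_swap:
  assumes "0 < \<alpha> (Suc i)"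
  shows "trunc_alternant N (\<alpha>(i := \<alpha> (Suc i) - 1, Suc i := Suc (\<alpha> i))) = - trunc_alternant N \<alpha>"
proof (cases "Suc i < N")
  case True
  then have iff: "(\<forall>k\<ge>N. (\<alpha>(i := \<alpha> (Suc i) - 1, Suc i := Suc (\<alpha> i))) k = 0) \<longleftrightarrow> (\<forall>k\<ge>N. \<alpha> k = 0)"
    by auto
  show ?thesis
    unfolding trunc_alternant_def iff alternant_swap[of i N \<alpha> xvar, OF True assms] by auto
next
  case False
  then show ?thesis using assms trunc_alternant_beyond[of N "Suc i"] by simp
qed

lemma power_sum_times_trunc_alternant:
  "power_sum r N * trunc_alternant N \<alpha> = (\<Sum>k<N. trunc_alternant N (\<alpha>(k := \<alpha> k + r)))"
proof (cases "\<forall>i\<ge>N. \<alpha> i = 0")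
  case True
  then show ?thesis
    using power_sum_times_alternant[of xvar r N \<alpha>]
    by (simp add: trunc_alternant_def power_sum_eq)
next
  case False
  then obtain i where "N \<le> i" "\<alpha> i \<noteq> 0" by auto
  then have "\<not> (\<forall>i\<ge>N. (\<alpha>(k := \<alpha> k + r)) i = 0)" for k by (auto intro!: exI[of _ i])
  then show ?thesis using False by (simp only: trunc_alternant_def) simp
qed

section \<open>The elementary and complete functions of degree two\<close>

definition elem2 :: symfun where
  "elem2 N = (\<Sum>j<N. \<Sum>i<j. xvar i * xvar j)"

text \<open>This is the complete homogeneous function: the squares of the variables join the
  products of distinct ones.\<close>

definition hom2 :: symfun where
  "hom2 N = elem2 N + power_sum 2 N"

lemma symmetric_double_sum:
  fixes F :: "nat \<Rightarrow> nat \<Rightarrow> 'a::comm_ring_1"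
  assumes "\<And>i j. F i j = F j i"
  shows "(\<Sum>i<N. \<Sum>j<N. F i j) = 2 * (\<Sum>j<N. \<Sum>i<j. F i j) + (\<Sum>i<N. F i i)"
proof (induction N)
  case (Suc N)
  have "(\<Sum>j<N. F N j) = (\<Sum>j<N. F j N)" by (rule sum.cong) (simp_all add: assms)
  with Suc show ?case by (simp add: sum.distrib algebra_simps)
qed simp

lemma power_sum_1_squared: "power_sum 1 N ^ 2 = 2 * elem2 N + power_sum 2 N"
  using symmetric_double_sum[of "\<lambda>i j. xvar i * xvar j" N, OF mult.commute]
  unfolding power_sum_eq elem2_def power2_eq_square sum_product power_one_right .

lemma power_sum_1_squared': "power_sum 1 N ^ 2 = hom2 N + elem2 N"
  unfolding power_sum_1_squared hom2_def by simp

lemma power_sum_2_eq: "power_sum 2 N = hom2 N - elem2 N"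
  by (simp add: hom2_def)

definition bump :: "(nat \<Rightarrow> nat) \<Rightarrow> nat \<Rightarrow> nat \<Rightarrow> nat" where
  "bump \<alpha> k = \<alpha>(k := Suc (\<alpha> k))"

lemma bump_apply: "bump \<alpha> k i = (if i = k then Suc (\<alpha> i) else \<alpha> i)"
  by (simp add: bump_def)

lemma bump_commute: "bump (bump \<alpha> i) j = bump (bump \<alpha> j) i"
  by (auto simp: bump_def)

lemma power_sum_1_times_trunc_alternant:
  "power_sum 1 N * trunc_alternant N \<alpha> = (\<Sum>k<N. trunc_alternant N (bump \<alpha> k))"
  using power_sum_times_trunc_alternant[of 1 N \<alpha>] by (simp add: bump_def)

text \<open>From \<open>2 * e2 = p1^2 - p2\<close>: multiplying by \<open>p1\<close> twice adds two
  boxes in all ordered ways, and the diagonal terms are the contribution of \<open>p2\<close>. The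
  factor 2 cancels over the integers.\<close>

lemma elem2_times_trunc_alternant:
  "elem2 N * trunc_alternant N \<alpha> = (\<Sum>j<N. \<Sum>i<j. trunc_alternant N (bump (bump \<alpha> i) j))"
proof -
  have "2 * (elem2 N * trunc_alternant N \<alpha>)
      = power_sum 1 N * (power_sum 1 N * trunc_alternant N \<alpha>) - power_sum 2 N * trunc_alternant N \<alpha>"
    unfolding mult.assoc[symmetric] left_diff_distrib[symmetric]
    using power_sum_1_squared[of N] by (simp add: power2_eq_square)
  also have "power_sum 1 N * (power_sum 1 N * trunc_alternant N \<alpha>)
      = (\<Sum>i<N. \<Sum>j<N. trunc_alternant N (bump (bump \<alpha> i) j))"
    unfolding power_sum_1_times_trunc_alternant sum_distrib_left ..
  also have "\<dots> = 2 * (\<Sum>j<N. \<Sum>i<j. trunc_alternant N (bump (bump \<alpha> i) j))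
      + (\<Sum>i<N. trunc_alternant N (bump (bump \<alpha> i) i))"
    by (rule symmetric_double_sum) (simp add: bump_commute)
  also have "(\<Sum>i<N. trunc_alternant N (bump (bump \<alpha> i) i)) = power_sum 2 N * trunc_alternant N \<alpha>"
    unfolding power_sum_times_trunc_alternant by (simp add: bump_def)
  finally show ?thesis by simp
qed

lemma hom2_times_trunc_alternant:
  "hom2 N * trunc_alternant N \<alpha> = (\<Sum>j<N. \<Sum>i\<le>j. trunc_alternant N (bump (bump \<alpha> i) j))"
proof -
  have "power_sum 2 N * trunc_alternant N \<alpha> = (\<Sum>i<N. trunc_alternant N (bump (bump \<alpha> i) i))"
    unfolding power_sum_times_trunc_alternant by (simp add: bump_def)
  then show ?thesis
    by (simp add: hom2_def distrib_right elem2_times_trunc_alternant sum.distrib[symmetric]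
        lessThan_Suc_atMost[symmetric])
qed

section \<open>Pieri rules\<close>

lemma is_shape_bump:
  assumes "is_shape \<alpha>" "antimono (bump \<alpha> k)"
  shows "is_shape (bump \<alpha> k)"
proof -
  obtain L where "\<forall>i\<ge>L. \<alpha> i = 0" using assms by (auto simp: is_shape_def)
  then show ?thesis using assms(2)
    by (auto simp: is_shape_def bump_apply intro!: exI[of _ "max L (Suc k)"])
qed

lemma is_shape_bump2:
  assumes "is_shape \<alpha>" "antimono (bump (bump \<alpha> i) j)"
  shows "is_shape (bump (bump \<alpha> i) j)"
proof -
  obtain L where "\<forall>k\<ge>L. \<alpha> k = 0" using assms by (auto simp: is_shape_def)
  then show ?thesis using assms(2)
    by (auto simp: is_shape_def bump_apply intro!: exI[of _ "max L (max (Suc i) (Suc j))"])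
qed

lemma trunc_alternant_bump_nonzeroD: "trunc_alternant N (bump \<alpha> k) \<noteq> 0 \<Longrightarrow> k < N"
  by (metis bump_apply not_less trunc_alternant_beyond zero_less_Suc)

lemma not_antimonoE:
  fixes \<alpha> :: "nat \<Rightarrow> nat"
  assumes "\<not> antimono \<alpha>"
  obtains k where "\<alpha> k < \<alpha> (Suc k)"
  using assms unfolding decseq_Suc_iff by (auto simp: not_le)

text \<open>Adding one box to a shape gives a shape or two equal exponents in adjacent rows, hence
  zero. Truncation kills the rows beyond \<open>N\<close>, so \<open>?D\<close> serves every
  \<open>N\<close>.\<close>

lemma schur_multiplier_power_sum_1: "schur_multiplier (power_sum 1)"
proof (rule schur_multiplierI)
  fix \<alpha> :: "nat \<Rightarrow> nat" assume \<alpha>: "is_shape \<alpha>"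
  then have anti: "\<alpha> (Suc k) \<le> \<alpha> k" for k by (simp add: is_shape_def antimono_def)
  obtain L where L: "\<forall>i\<ge>L. \<alpha> i = 0" using \<alpha> by (auto simp: is_shape_def)
  let ?D = "{k. antimono (bump \<alpha> k)}"
  have "?D \<subseteq> {..L}"
  proof
    fix k assume k: "k \<in> ?D"
    show "k \<in> {..L}"
    proof (rule ccontr)
      assume "k \<notin> {..L}"
      then have "bump \<alpha> k (k - 1) = 0" "bump \<alpha> k k > 0" using L by (auto simp: bump_apply)
      moreover have "bump \<alpha> k k \<le> bump \<alpha> k (k - 1)"
        using k by (auto intro: antimonoD)
      ultimately show False by simp
    qed
  qed
  then have fin: "finite ?D" by (rule finite_subset) simp
  have bad: "trunc_alternant N (bump \<alpha> k) = 0" if k: "k \<notin> ?D" for N k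
  proof -
    obtain m where m: "bump \<alpha> k m < bump \<alpha> k (Suc m)" using k not_antimonoE by blast
    then have "bump \<alpha> k (Suc m) = bump \<alpha> k m + (Suc m - m)"
      using anti[of m] by (auto simp: bump_apply split: if_splits)
    then show ?thesis by (intro trunc_alternant_eq_0[of m "Suc m"]) auto
  qed
  show "schur_positive (\<lambda>N. power_sum 1 N * tableau_sum xvar \<alpha> N)"
  proof (rule schur_positive_from_alternants[OF fin])
    show "is_shape (bump \<alpha> k)" if "k \<in> ?D" for k using is_shape_bump[OF \<alpha>] that by simp
    fix N
    have "vandermonde N * (power_sum 1 N * tableau_sum xvar \<alpha> N) = power_sum 1 N * trunc_alternant N \<alpha>"
      by (simp add: trunc_alternant_shape[OF \<alpha>] mult.left_commute)
    also have "\<dots> = (\<Sum>k<N. trunc_alternant N (bump \<alpha> k))"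
      by (rule power_sum_1_times_trunc_alternant)
    also have "\<dots> = (\<Sum>k\<in>{..<N} \<inter> ?D. trunc_alternant N (bump \<alpha> k))"
      by (rule sum.mono_neutral_right) (use bad in auto)
    also have "\<dots> = (\<Sum>k\<in>?D. trunc_alternant N (bump \<alpha> k))"
      by (rule sum.mono_neutral_left)
        (use fin in \<open>auto dest: trunc_alternant_bump_nonzeroD\<close>)
    finally show "vandermonde N * (power_sum 1 N * tableau_sum xvar \<alpha> N)
      = (\<Sum>k\<in>?D. trunc_alternant N (bump \<alpha> k))" .
  qed
qed

lemma finite_antimono_bump2:
  assumes "is_shape \<alpha>"
  shows "finite {(i, j). i \<le> j \<and> antimono (bump (bump \<alpha> i) j)}"
proof -
  obtain L where L: "\<forall>i\<ge>L. \<alpha> i = 0" using assms by (auto simp: is_shape_def)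
  have "{(i, j). i \<le> j \<and> antimono (bump (bump \<alpha> i) j)} \<subseteq> {..L} \<times> {..Suc L}"
  proof (rule subrelI, rule ccontr)
    fix i j assume "(i, j) \<in> {(i, j). i \<le> j \<and> antimono (bump (bump \<alpha> i) j)}"
      and n: "(i, j) \<notin> {..L} \<times> {..Suc L}"
    then have ij: "i \<le> j" and anti: "antimono (bump (bump \<alpha> i) j)" by auto
    let ?\<gamma> = "bump (bump \<alpha> i) j"
    have step: "?\<gamma> k \<le> ?\<gamma> (k - 1)" for k using anti by (auto intro: antimonoD)
    show False
    proof (cases "i \<le> L")
      case True
      then have "?\<gamma> j > 0" "?\<gamma> (j - 1) = 0" using n L by (auto simp: bump_apply)
      then show False using step[of j] by simp
    next
      case False
      then have "?\<gamma> i > 0" "?\<gamma> (i - 1) = 0" using ij L by (auto simp: bump_apply)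
      then show False using step[of i] by simp
    qed
  qed
  then show ?thesis by (rule finite_subset) simp
qed

text \<open>With boxes in different rows, a row can exceed the one above it by at most one, which
  makes two exponents equal. Two boxes in one row could overshoot by two, hence
  \<open>i < j\<close>.\<close>

lemma trunc_alternant_bump2_eq_0:
  assumes \<alpha>: "antimono \<alpha>" and "i < j" "\<not> antimono (bump (bump \<alpha> i) j)"
  shows "trunc_alternant N (bump (bump \<alpha> i) j) = 0"
proof -
  let ?\<gamma> = "bump (bump \<alpha> i) j"
  obtain m where m: "?\<gamma> m < ?\<gamma> (Suc m)" using assms not_antimonoE by blast
  have "\<alpha> (Suc m) \<le> \<alpha> m" using \<alpha> by (auto intro: antimonoD)
  with m have "?\<gamma> (Suc m) = ?\<gamma> m + (Suc m - m)"
    using \<open>i < j\<close> by (auto simp: bump_apply split: if_splits)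
  then show ?thesis by (intro trunc_alternant_eq_0[of m "Suc m"]) auto
qed

text \<open>The Pieri rule for vertical strips of size two: terms that are not shapes vanish, and
  all others have coefficient one.\<close>

lemma schur_multiplier_elem2: "schur_multiplier elem2"
proof (rule schur_multiplierI)
  fix \<alpha> :: "nat \<Rightarrow> nat" assume \<alpha>: "is_shape \<alpha>"
  then have anti: "antimono \<alpha>" by (simp add: is_shape_def)
  let ?g = "\<lambda>N (i, j). trunc_alternant N (bump (bump \<alpha> i) j)"
  let ?D = "{(i, j). i < j \<and> antimono (bump (bump \<alpha> i) j)}"
  let ?P = "\<lambda>N. {(i, j). i < j \<and> j < (N::nat)}"
  have fin: "finite ?D"
    by (rule finite_subset[OF _ finite_antimono_bump2[OF \<alpha>]]) auto
  have finP: "finite (?P N)" for N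
    by (rule finite_subset[of _ "{..<N} \<times> {..<N}"]) auto
  show "schur_positive (\<lambda>N. elem2 N * tableau_sum xvar \<alpha> N)"
  proof (rule schur_positive_from_alternants[OF fin, of "\<lambda>(i, j). bump (bump \<alpha> i) j"])
    show "is_shape (case d of (i, j) \<Rightarrow> bump (bump \<alpha> i) j)" if "d \<in> ?D" for d
      using is_shape_bump2[OF \<alpha>] that by auto
    fix N
    have "vandermonde N * (elem2 N * tableau_sum xvar \<alpha> N) = elem2 N * trunc_alternant N \<alpha>"
      by (simp add: trunc_alternant_shape[OF \<alpha>] mult.left_commute)
    also have "\<dots> = (\<Sum>j<N. \<Sum>i<j. ?g N (i, j))"
      by (simp add: elem2_times_trunc_alternant)
    also have "\<dots> = (\<Sum>(j, i)\<in>(SIGMA j:{..<N}. {..<j}). ?g N (i, j))"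
      by (rule sum.Sigma) auto
    also have "\<dots> = (\<Sum>d\<in>?P N. ?g N d)"
      by (rule sum.reindex_bij_witness[of _ prod.swap prod.swap]) auto
    also have "\<dots> = (\<Sum>d\<in>?P N \<inter> ?D. ?g N d)"
      by (rule sum.mono_neutral_right[OF finP])
        (use trunc_alternant_bump2_eq_0[OF anti] in auto)
    also have "\<dots> = (\<Sum>d\<in>?D. ?g N d)"
      by (rule sum.mono_neutral_left[OF fin])
        (auto dest: trunc_alternant_bump_nonzeroD)
    finally show "vandermonde N * (elem2 N * tableau_sum xvar \<alpha> N)
      = (\<Sum>d\<in>?D. trunc_alternant N (case d of (i, j) \<Rightarrow> bump (bump \<alpha> i) j))"
      by (simp add: case_prod_unfold)
  qed
qed

text \<open>The Pieri rule for horizontal strips of size two. The unwanted vertical dominoes cancel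
  against terms with two boxes in the same row.\<close>

lemma schur_multiplier_hom2: "schur_multiplier hom2"
proof (rule schur_multiplierI)
  fix \<alpha> :: "nat \<Rightarrow> nat" assume \<alpha>: "is_shape \<alpha>"
  then have anti: "antimono \<alpha>" by (simp add: is_shape_def)
  let ?F = "\<lambda>N i j. trunc_alternant N (bump (bump \<alpha> i) j)"
  \<comment> \<open>\<open>cancels\<close> marks both members of a cancelling pair: the vertical
    domino below equal rows' tops and the double box in the lower of the two equal rows.\<close>
  define cancels where "cancels i j \<longleftrightarrow> (j = Suc i \<and> \<alpha> i = \<alpha> j) \<or> (i = j \<and> 0 < j \<and> \<alpha> (j - 1) = \<alpha> j)" for i j
  define F' where "F' N d = (case d of (i, j) \<Rightarrow> if cancels i j then 0 else ?F N i j)" for N d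
  let ?D = "{(i, j). i \<le> j \<and> antimono (bump (bump \<alpha> i) j) \<and> \<not> cancels i j}"
  let ?P = "\<lambda>N. {(i, j). i \<le> j \<and> j < (N::nat)}"
  have fin: "finite ?D"
    by (rule finite_subset[OF _ finite_antimono_bump2[OF \<alpha>]]) auto
  have finP: "finite (?P N)" for N
    by (rule finite_subset[of _ "{..<N} \<times> {..<N}"]) auto
  \<comment> \<open>If rows \<open>k\<close> and \<open>k + 1\<close> are equal, two boxes added to row \<open>k + 1\<close> straighten to minus the vertical domino.\<close>
  have pair: "?F N k (Suc k) = - ?F N (Suc k) (Suc k)" if "\<alpha> k = \<alpha> (Suc k)" for N k
  proof -
    let ?\<gamma> = "bump (bump \<alpha> (Suc k)) (Suc k)"
    have "?\<gamma>(k := ?\<gamma> (Suc k) - 1, Suc k := Suc (?\<gamma> k)) = bump (bump \<alpha> k) (Suc k)"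
      using that by (auto simp: bump_apply fun_eq_iff)
    then show ?thesis using trunc_alternant_swap[of ?\<gamma> k N] by (simp add: bump_apply)
  qed
  \<comment> \<open>Both members of a pair have the same second index, so the cancellation happens
    inside the inner sum.\<close>
  have row: "(\<Sum>i\<le>j. ?F N i j) = (\<Sum>i\<le>j. F' N (i, j))" for N j
  proof (cases j)
    case 0
    then show ?thesis by (simp add: F'_def cancels_def)
  next
    case (Suc k)
    have "(\<Sum>i<k. ?F N i j) = (\<Sum>i<k. F' N (i, j))"
      by (rule sum.cong) (auto simp: F'_def cancels_def Suc)
    moreover have "?F N k j + ?F N j j = F' N (k, j) + F' N (j, j)"
      using pair[of k N] by (auto simp: F'_def cancels_def Suc)
    ultimately show ?thesis
      by (simp add: Suc lessThan_Suc_atMost[symmetric] add.assoc)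
  qed
  have zero: "F' N (i, j) = 0" if ij: "i \<le> j" "(i, j) \<notin> ?D" for N i j
  proof (cases "cancels i j")
    case True
    then show ?thesis by (simp add: F'_def)
  next
    case nc: False
    then have na: "\<not> antimono (bump (bump \<alpha> i) j)" using ij by simp
    show ?thesis
    proof (cases "i < j")
      case True
      then show ?thesis using trunc_alternant_bump2_eq_0[OF anti True na] by (simp add: F'_def)
    next
      case False
      then have "i = j" using ij by simp
      obtain m where m: "bump (bump \<alpha> j) j m < bump (bump \<alpha> j) j (Suc m)"
        using na not_antimonoE unfolding \<open>i = j\<close> by blast
      have "\<alpha> (Suc m) \<le> \<alpha> m" using anti by (auto intro: antimonoD)
      with m have "j = Suc m" by (auto simp: bump_apply split: if_splits)
      \<comment> \<open>Two boxes overshoot the row above only if it is longer by at most one. Equal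
        rows are excluded by \<open>nc\<close>, and a difference of one repeats an exponent.\<close>
      moreover from this have "\<alpha> m = Suc (\<alpha> (Suc m))"
        using m \<open>\<alpha> (Suc m) \<le> \<alpha> m\<close> \<open>i = j\<close> nc by (auto simp: bump_apply cancels_def split: if_splits)
      ultimately have "?F N j j = 0"
        by (intro trunc_alternant_eq_0[of m "Suc m"]) (auto simp: bump_apply)
      then show ?thesis by (simp add: F'_def \<open>i = j\<close>)
    qed
  qed
  show "schur_positive (\<lambda>N. hom2 N * tableau_sum xvar \<alpha> N)"
  proof (rule schur_positive_from_alternants[OF fin, of "\<lambda>(i, j). bump (bump \<alpha> i) j"])
    show "is_shape (case d of (i, j) \<Rightarrow> bump (bump \<alpha> i) j)" if "d \<in> ?D" for d
      using is_shape_bump2[OF \<alpha>] that by auto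
    fix N
    have "vandermonde N * (hom2 N * tableau_sum xvar \<alpha> N) = hom2 N * trunc_alternant N \<alpha>"
      by (simp add: trunc_alternant_shape[OF \<alpha>] mult.left_commute)
    also have "\<dots> = (\<Sum>j<N. \<Sum>i\<le>j. F' N (i, j))"
      by (simp only: hom2_times_trunc_alternant row)
    also have "\<dots> = (\<Sum>(j, i)\<in>(SIGMA j:{..<N}. {..j}). F' N (i, j))"
      by (rule sum.Sigma) auto
    also have "\<dots> = (\<Sum>d\<in>?P N. F' N d)"
      by (rule sum.reindex_bij_witness[of _ prod.swap prod.swap]) auto
    also have "\<dots> = (\<Sum>d\<in>?P N \<inter> ?D. F' N d)"
      by (rule sum.mono_neutral_right[OF finP]) (use zero in auto)
    also have "\<dots> = (\<Sum>d\<in>?D. F' N d)"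
      by (rule sum.mono_neutral_left[OF fin])
        (auto simp: F'_def dest: trunc_alternant_bump_nonzeroD)
    also have "\<dots> = (\<Sum>d\<in>?D. trunc_alternant N (case d of (i, j) \<Rightarrow> bump (bump \<alpha> i) j))"
      by (rule sum.cong) (auto simp: F'_def)
    finally show "vandermonde N * (hom2 N * tableau_sum xvar \<alpha> N)
      = (\<Sum>d\<in>?D. trunc_alternant N (case d of (i, j) \<Rightarrow> bump (bump \<alpha> i) j))" .
  qed
qed

text \<open>Adding \<open>r\<close> to a row at least \<open>r\<close> rows below the shape repeats an exponent, so four rows
  suffice for everything of degree at most four.\<close>

definition alternant4 :: "nat \<Rightarrow> nat \<Rightarrow> nat \<Rightarrow> nat \<Rightarrow> nat \<Rightarrow> ipoly" where
  "alternant4 N a b c d = trunc_alternant N (shape [a, b, c, d])"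

lemma power_sum_times_trunc_alternant_bounded:
  assumes L: "\<forall>i\<ge>L. \<alpha> i = 0" and r: "0 < r" and K: "L + r \<le> K"
  shows "power_sum r N * trunc_alternant N \<alpha> = (\<Sum>k<K. trunc_alternant N (\<alpha>(k := \<alpha> k + r)))"
proof -
  have "trunc_alternant N (\<alpha>(k := \<alpha> k + r)) = 0" if "K \<le> k" for k
    using that L r K by (intro trunc_alternant_eq_0[of "k - r" k]) auto
  moreover have "trunc_alternant N (\<alpha>(k := \<alpha> k + r)) = 0" if "N \<le> k" for k
    using that r by (intro trunc_alternant_beyond[of N k]) auto
  ultimately show ?thesis
    unfolding power_sum_times_trunc_alternant
    by (intro sum.mono_neutral_cong) (auto simp: not_less)
qed

text \<open>The second premise leaves the last \<open>r\<close> of the four rows empty, so the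
  bounded rule applies with \<open>L = 4 - r\<close> and \<open>K = 4\<close>.\<close>

lemma power_sum_times_alternant4:
  assumes "0 < r" "\<forall>i\<in>{4 - r..<4}. [a, b, c, d] ! i = 0" "r \<le> 4"
  shows "power_sum r N * alternant4 N a b c d = alternant4 N (a + r) b c d
    + alternant4 N a (b + r) c d + alternant4 N a b (c + r) d + alternant4 N a b c (d + r)"
proof -
  have "\<forall>i\<ge>4 - r. shape [a, b, c, d] i = 0" using assms(2) by (auto simp: shape_def)
  then have "power_sum r N * alternant4 N a b c d
      = (\<Sum>k<4. trunc_alternant N ((shape [a, b, c, d])(k := shape [a, b, c, d] k + r)))"
    unfolding alternant4_def
    by (rule power_sum_times_trunc_alternant_bounded) (use assms in auto)
  moreover have "(shape [a, b, c, d])(0 := shape [a, b, c, d] 0 + r) = shape [a + r, b, c, d]"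
    "(shape [a, b, c, d])(1 := shape [a, b, c, d] 1 + r) = shape [a, b + r, c, d]"
    "(shape [a, b, c, d])(2 := shape [a, b, c, d] 2 + r) = shape [a, b, c + r, d]"
    "(shape [a, b, c, d])(3 := shape [a, b, c, d] 3 + r) = shape [a, b, c, d + r]"
    by (auto simp: shape_def fun_eq_iff less_Suc_eq numeral_2_eq_2 numeral_3_eq_3)
  ultimately show ?thesis
    by (simp add: alternant4_def numeral_eq_Suc)
qed

section \<open>Identities in degrees three and four\<close>

lemma alternant4_swap:
  "0 < b \<Longrightarrow> alternant4 N a b c d = - alternant4 N (b - 1) (Suc a) c d"
  "0 < c \<Longrightarrow> alternant4 N a b c d = - alternant4 N a (c - 1) (Suc b) d"
  "0 < d \<Longrightarrow> alternant4 N a b c d = - alternant4 N a b (d - 1) (Suc c)"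
proof -
  let ?\<alpha> = "shape [a, b, c, d]"
  have 1: "?\<alpha>(0 := ?\<alpha> (Suc 0) - 1, Suc 0 := Suc (?\<alpha> 0)) = shape [b - 1, Suc a, c, d]"
    "?\<alpha>(Suc 0 := ?\<alpha> (Suc (Suc 0)) - 1, Suc (Suc 0) := Suc (?\<alpha> (Suc 0))) = shape [a, c - 1, Suc b, d]"
    "?\<alpha>(Suc (Suc 0) := ?\<alpha> (Suc (Suc (Suc 0))) - 1, Suc (Suc (Suc 0)) := Suc (?\<alpha> (Suc (Suc 0))))
      = shape [a, b, d - 1, Suc c]"
    by (auto simp: shape_def fun_eq_iff less_Suc_eq)
  show "0 < b \<Longrightarrow> alternant4 N a b c d = - alternant4 N (b - 1) (Suc a) c d"
    using trunc_alternant_swap[of ?\<alpha> 0 N] unfolding 1 by (simp add: alternant4_def shape_def)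
  show "0 < c \<Longrightarrow> alternant4 N a b c d = - alternant4 N a (c - 1) (Suc b) d"
    using trunc_alternant_swap[of ?\<alpha> "Suc 0" N] unfolding 1 by (simp add: alternant4_def shape_def)
  show "0 < d \<Longrightarrow> alternant4 N a b c d = - alternant4 N a b (d - 1) (Suc c)"
    using trunc_alternant_swap[of ?\<alpha> "Suc (Suc 0)" N] unfolding 1 by (simp add: alternant4_def shape_def)
qed

text \<open>The six cases are the possible coincidences among \<open>a + 3\<close>,
  \<open>b + 2\<close>, \<open>c + 1\<close> and \<open>d\<close>.\<close>

lemma alternant4_eq_0:
  assumes "b = Suc a \<or> c = Suc b \<or> d = Suc c \<or> c = a + 2 \<or> d = b + 2 \<or> d = a + 3"
  shows "alternant4 N a b c d = 0"
proof -
  have "\<exists>i j. i < j \<and> shape [a, b, c, d] j = shape [a, b, c, d] i + (j - i)"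
    using assms
  proof (elim disjE)
    assume "b = Suc a" then show ?thesis by (intro exI[of _ 0] exI[of _ 1]) (simp add: shape_def)
  next
    assume "c = Suc b" then show ?thesis by (intro exI[of _ 1] exI[of _ 2]) (simp add: shape_def)
  next
    assume "d = Suc c" then show ?thesis by (intro exI[of _ 2] exI[of _ 3]) (simp add: shape_def)
  next
    assume "c = a + 2" then show ?thesis by (intro exI[of _ 0] exI[of _ 2]) (simp add: shape_def)
  next
    assume "d = b + 2" then show ?thesis by (intro exI[of _ 1] exI[of _ 3]) (simp add: shape_def)
  next
    assume "d = a + 3" then show ?thesis by (intro exI[of _ 0] exI[of _ 3]) (simp add: shape_def)
  qed
  then show ?thesis unfolding alternant4_def using trunc_alternant_eq_0 by blast
qed

lemma vandermonde_alternant4: "vandermonde N = alternant4 N 0 0 0 0"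
proof -
  have "shape [0, 0, 0, 0] = (\<lambda>_. 0)" by (auto simp: shape_def fun_eq_iff less_Suc_eq)
  then show ?thesis by (simp add: alternant4_def vandermonde_def trunc_alternant_def)
qed

lemma is_shape_4: "d \<le> c \<Longrightarrow> c \<le> b \<Longrightarrow> b \<le> a \<Longrightarrow> is_shape (shape [a, b, c, d])"
  unfolding is_shape_def decseq_Suc_iff
  by (auto simp: shape_def less_Suc_eq intro!: exI[of _ 4])

lemma power_sum_1_alternant4:
  "power_sum 1 N * alternant4 N a b c 0 = alternant4 N (Suc a) b c 0
    + alternant4 N a (Suc b) c 0 + alternant4 N a b (Suc c) 0 + alternant4 N a b c 1"
  using power_sum_times_alternant4[of 1 a b c 0 N] by simp

lemma power_sum_2_alternant4:
  "power_sum 2 N * alternant4 N a b 0 0 = alternant4 N (a + 2) b 0 0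
    + alternant4 N a (b + 2) 0 0 + alternant4 N a b 2 0 + alternant4 N a b 0 2"
proof -
  have "i = 2 \<or> i = 3" if "i \<in> {4 - 2..<4}" for i :: nat using that by auto
  then show ?thesis
    using power_sum_times_alternant4[of 2 a b 0 0 N] by (fastforce simp: numeral_3_eq_3 numeral_2_eq_2)
qed

lemma power_sum_3_alternant4:
  "power_sum 3 N * alternant4 N a 0 0 0 = alternant4 N (a + 3) 0 0 0
    + alternant4 N a 3 0 0 + alternant4 N a 0 3 0 + alternant4 N a 0 0 3"
proof -
  have "i = 1 \<or> i = 2 \<or> i = 3" if "i \<in> {4 - 3..<4}" for i :: nat using that by auto
  then show ?thesis
    using power_sum_times_alternant4[of 3 a 0 0 0 N] by (fastforce simp: numeral_3_eq_3 numeral_2_eq_2)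
qed

context
  fixes N :: nat
begin

private abbreviation "g \<equiv> alternant4 N"
private abbreviation "p1 \<equiv> power_sum 1 N"
private abbreviation "p2 \<equiv> power_sum 2 N"
private abbreviation "p3 \<equiv> power_sum 3 N"

lemma power_sum_1_small:
  "p1 * g 0 0 0 0 = g 1 0 0 0" "p1 * g 1 0 0 0 = g 2 0 0 0 + g 1 1 0 0"
  "p1 * g 2 0 0 0 = g 3 0 0 0 + g 2 1 0 0" "p1 * g 1 1 0 0 = g 2 1 0 0 + g 1 1 1 0"
  "p1 * g 3 0 0 0 = g 4 0 0 0 + g 3 1 0 0" "p1 * g 2 1 0 0 = g 3 1 0 0 + g 2 2 0 0 + g 2 1 1 0"
  "p1 * g 1 1 1 0 = g 2 1 1 0 + g 1 1 1 1"
  unfolding power_sum_1_alternant4 by (simp_all add: alternant4_eq_0 numeral_eq_Suc)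

text \<open>The border strip rule for dominoes; each minus sign comes from one exchange of adjacent
  rows.\<close>

lemma power_sum_2_small:
  "p2 * g 0 0 0 0 = g 2 0 0 0 - g 1 1 0 0"
  "p2 * g 2 0 0 0 = g 4 0 0 0 + g 2 2 0 0 - g 2 1 1 0"
  "p2 * g 1 1 0 0 = g 3 1 0 0 - g 2 2 0 0 - g 1 1 1 1"
proof -
  have "g 0 2 0 0 = - g 1 1 0 0" "g 2 0 2 0 = - g 2 1 1 0"
    "g 1 3 0 0 = - g 2 2 0 0" "g 1 1 0 2 = - g 1 1 1 1"
    using alternant4_swap(1)[of 2 N 0 0 0] alternant4_swap(2)[of 2 N 2 0 0]
      alternant4_swap(1)[of 3 N 1 0 0] alternant4_swap(3)[of 2 N 1 1 0]
    by (simp_all add: numeral_eq_Suc)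
  then show "p2 * g 0 0 0 0 = g 2 0 0 0 - g 1 1 0 0"
    "p2 * g 2 0 0 0 = g 4 0 0 0 + g 2 2 0 0 - g 2 1 1 0"
    "p2 * g 1 1 0 0 = g 3 1 0 0 - g 2 2 0 0 - g 1 1 1 1"
    unfolding power_sum_2_alternant4 by (simp_all add: alternant4_eq_0 numeral_eq_Suc)
qed

text \<open>The three hooks of size three, with signs from zero, one and two row exchanges.\<close>

lemma power_sum_3_small: "p3 * g 0 0 0 0 = g 3 0 0 0 - g 2 1 0 0 + g 1 1 1 0"
proof -
  have "g 0 3 0 0 = - g 2 1 0 0" using alternant4_swap(1)[of 3 N 0 0 0] by (simp add: numeral_eq_Suc)
  moreover have "g 0 0 3 0 = g 1 1 1 0"
    using alternant4_swap(2)[of 3 N 0 0 0] alternant4_swap(1)[of 2 N 0 1 0] by (simp add: numeral_eq_Suc)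
  ultimately show ?thesis unfolding power_sum_3_alternant4 by (simp add: alternant4_eq_0)
qed

text \<open>This settles \<open>n = 3\<close>, which lies below the range of the general
  argument.\<close>

lemma degree_3_identity:
  "vandermonde N * (p3 + p1 ^ 3 + p2 * p1) = 3 * g 3 0 0 0 + g 2 1 0 0 + g 1 1 1 0"
proof -
  have "vandermonde N * (p3 + p1 ^ 3 + p2 * p1)
      = p3 * g 0 0 0 0 + p1 * (p1 * (p1 * g 0 0 0 0)) + p1 * (p2 * g 0 0 0 0)"
    unfolding vandermonde_alternant4 by (simp add: power3_eq_cube algebra_simps)
  also have "\<dots> = 3 * g 3 0 0 0 + g 2 1 0 0 + g 1 1 1 0"
    unfolding power_sum_3_small power_sum_2_small power_sum_1_small distrib_left right_diff_distrib
    by simp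
  finally show ?thesis .
qed

text \<open>The coefficients are rows of the character table of the symmetric group on four
  letters.\<close>

lemma degree_4_products:
  "p1 * (p1 * (p1 * (p1 * g 0 0 0 0)))
     = g 4 0 0 0 + 3 * g 3 1 0 0 + 2 * g 2 2 0 0 + 3 * g 2 1 1 0 + g 1 1 1 1"
  "p1 * (p1 * (p2 * g 0 0 0 0)) = g 4 0 0 0 + g 3 1 0 0 - g 2 1 1 0 - g 1 1 1 1"
  "p2 * (p2 * g 0 0 0 0) = g 4 0 0 0 - g 3 1 0 0 + 2 * g 2 2 0 0 - g 2 1 1 0 + g 1 1 1 1"
  "p1 * (p3 * g 0 0 0 0) = g 4 0 0 0 - g 2 2 0 0 + g 1 1 1 1"
  unfolding power_sum_3_small power_sum_2_small power_sum_1_small distrib_left right_diff_distrib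
  by simp_all

lemma degree_4_identity_hom:
  "vandermonde N * (p3 * p1 + hom2 N ^ 2) = 2 * g 4 0 0 0 + g 3 1 0 0 + g 1 1 1 1"
proof -
  \<comment> \<open>Since \<open>2 * h = a^2 + b\<close>, the factor 4 clears the denominators of
    \<open>h^2\<close>; it is cancelled at the end.\<close>
  have expand: "4 * (v * (c * a + h ^ 2)) = 4 * (a * (c * v)) + a * (a * (a * (a * v)))
      + 2 * (a * (a * (b * v))) + b * (b * v)"
    if "a ^ 2 = h + e" "b = h - e" for a b c h e v :: ipoly
    using that by Groebner_Basis.algebra
  have "4 * (vandermonde N * (p3 * p1 + hom2 N ^ 2))
      = 4 * (p1 * (p3 * g 0 0 0 0)) + p1 * (p1 * (p1 * (p1 * g 0 0 0 0)))
        + 2 * (p1 * (p1 * (p2 * g 0 0 0 0))) + p2 * (p2 * g 0 0 0 0)"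
    unfolding vandermonde_alternant4 by (rule expand[OF power_sum_1_squared' power_sum_2_eq])
  also have "\<dots> = 4 * (2 * g 4 0 0 0 + g 3 1 0 0 + g 1 1 1 1)"
    unfolding degree_4_products by Groebner_Basis.algebra
  finally show ?thesis by (subst (asm) mult_left_cancel) simp
qed

lemma degree_4_identity_mixed:
  "vandermonde N * (hom2 N ^ 2 - hom2 N * elem2 N + elem2 N ^ 2)
    = g 4 0 0 0 + 2 * g 2 2 0 0 + g 1 1 1 1"
proof -
  \<comment> \<open>This is
    \<open>4 * (h^2 - h*e + e^2) = (h + e)^2 + 3 * (h - e)^2\<close>.\<close>
  have expand: "4 * (v * (h ^ 2 - h * e + e ^ 2)) = a * (a * (a * (a * v))) + 3 * (b * (b * v))"
    if "a ^ 2 = h + e" "b = h - e" for a b h e v :: ipoly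
    using that by Groebner_Basis.algebra
  have "4 * (vandermonde N * (hom2 N ^ 2 - hom2 N * elem2 N + elem2 N ^ 2))
      = p1 * (p1 * (p1 * (p1 * g 0 0 0 0))) + 3 * (p2 * (p2 * g 0 0 0 0))"
    unfolding vandermonde_alternant4 by (rule expand[OF power_sum_1_squared' power_sum_2_eq])
  also have "\<dots> = 4 * (g 4 0 0 0 + 2 * g 2 2 0 0 + g 1 1 1 1)"
    unfolding degree_4_products by Groebner_Basis.algebra
  finally show ?thesis by (subst (asm) mult_left_cancel) simp
qed

end

text \<open>Repetitions in the list encode coefficients greater than one.\<close>

lemma schur_positive_from_shapes:
  assumes "\<forall>la\<in>set las. is_shape (shape la)"
    and "\<And>N. vandermonde N * f N = (\<Sum>la\<leftarrow>las. trunc_alternant N (shape la))"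
  shows "schur_positive f"
proof (rule schur_positive_from_alternants[of "{..<length las}" "\<lambda>k. shape (las ! k)"])
  show "vandermonde N * f N = (\<Sum>k<length las. trunc_alternant N (shape (las ! k)))" for N
    using assms(2) by (simp add: sum_list_sum_nth atLeast0LessThan)
qed (use assms(1) in auto)

lemma schur_positive_degree_3:
  "schur_positive (\<lambda>N. power_sum 3 N + power_sum 1 N ^ 3 + power_sum 2 N * power_sum 1 N)"
  by (rule schur_positive_from_shapes[of "[[3,0,0,0],[3,0,0,0],[3,0,0,0],[2,1,0,0],[1,1,1,0]]"])
    (simp add: is_shape_4, unfold degree_3_identity, simp add: alternant4_def)

lemma schur_positive_degree_4_hom:
  "schur_positive (\<lambda>N. power_sum 3 N * power_sum 1 N + hom2 N ^ 2)"
  by (rule schur_positive_from_shapes[of "[[4,0,0,0],[4,0,0,0],[3,1,0,0],[1,1,1,1]]"])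
    (simp add: is_shape_4, unfold degree_4_identity_hom, simp add: alternant4_def)

lemma schur_positive_degree_4_mixed:
  "schur_positive (\<lambda>N. hom2 N ^ 2 - hom2 N * elem2 N + elem2 N ^ 2)"
  by (rule schur_positive_from_shapes[of "[[4,0,0,0],[2,2,0,0],[2,2,0,0],[1,1,1,1]]"])
    (simp add: is_shape_4, unfold degree_4_identity_mixed, simp add: alternant4_def)

section \<open>Positivity of the partial sums\<close>

text \<open>The pair \<open>(a, b)\<close> with \<open>(h + e)\<^sup>m = a + e b\<close> and \<open>(h - e)\<^sup>m = a - e b\<close>; both are polynomials
  in \<open>h\<close> and \<open>e\<close> with nonnegative coefficients.\<close>

primrec even_odd :: "nat \<Rightarrow> 'a::comm_ring_1 \<Rightarrow> 'a \<Rightarrow> 'a \<times> 'a" where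
  "even_odd 0 h e = (1, 0)"
| "even_odd (Suc m) h e = (case even_odd m h e of (a, b) \<Rightarrow> (h * a + e\<^sup>2 * b, a + h * b))"

lemma power_add_even_odd: "(h + e) ^ m = fst (even_odd m h e) + e * snd (even_odd m h e)"
  by (induction m) (auto simp: case_prod_unfold algebra_simps power2_eq_square)

text \<open>This is the quotient of \<open>(h + e)^(k+1) - (h - e)^(k+1)\<close> by
  \<open>2 * e\<close>, obtained without division: if \<open>(h + e)^(k+1) = a + e*b\<close> and the
  sum for \<open>k\<close> is \<open>b\<close>, the next sum is
  \<open>a + e*b + (h - e)*b = a + h*b\<close>.\<close>

lemma geometric_sum_even_odd:
  fixes h e :: "'a::comm_ring_1"
  shows "(\<Sum>i\<le>k. (h - e) ^ i * (h + e) ^ (k - i)) = snd (even_odd (Suc k) h e)"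
proof (induction k)
  case (Suc k)
  have "(\<Sum>i\<le>Suc k. (h - e) ^ i * (h + e) ^ (Suc k - i))
      = (h + e) ^ Suc k + (h - e) * (\<Sum>i\<le>k. (h - e) ^ i * (h + e) ^ (k - i))"
    by (subst sum.atMost_Suc_shift) (simp add: sum_distrib_left mult.assoc)
  also have "\<dots> = snd (even_odd (Suc (Suc k)) h e)"
    unfolding Suc by (subst power_add_even_odd) (simp add: case_prod_unfold algebra_simps)
  finally show ?case .
qed simp

lemma schur_multiplier_even_odd:
  "schur_multiplier (\<lambda>N. fst (even_odd m (hom2 N) (elem2 N)))
   \<and> schur_multiplier (\<lambda>N. snd (even_odd m (hom2 N) (elem2 N)))"
proof (induction m)
  case 0
  then show ?case using schur_multiplier_of_nat[of 0] schur_multiplier_of_nat[of 1] by simp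
next
  case (Suc m)
  then show ?case
    by (auto simp: case_prod_unfold
        intro!: schur_multiplier_add schur_multiplier_mult schur_multiplier_power
          schur_multiplier_hom2 schur_multiplier_elem2)
qed

lemma two_one_sum_eq:
  assumes "2 * k \<le> n"
  shows "(\<Sum>i\<le>k. power_sum 2 N ^ i * power_sum 1 N ^ (n - 2 * i))
    = power_sum 1 N ^ (n - 2 * k) * snd (even_odd (Suc k) (hom2 N) (elem2 N))"
proof -
  have "power_sum 2 N ^ i * power_sum 1 N ^ (n - 2 * i) = power_sum 1 N ^ (n - 2 * k) *
      ((hom2 N - elem2 N) ^ i * (hom2 N + elem2 N) ^ (k - i))" if "i \<le> k" for i
  proof -
    have "n - 2 * i = (n - 2 * k) + 2 * (k - i)" using that assms by simp
    then show ?thesis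
      unfolding power_sum_1_squared'[symmetric] power_sum_2_eq[symmetric]
      by (simp only: power_add power_mult) (simp only: mult_ac)
  qed
  then show ?thesis
    unfolding geometric_sum_even_odd[symmetric] sum_distrib_left by (intro sum.cong) auto
qed

lemma schur_positive_two_one_sum:
  assumes "2 * k \<le> n"
  shows "schur_positive (\<lambda>N. \<Sum>i\<le>k. power_sum 2 N ^ i * power_sum 1 N ^ (n - 2 * i))"
  unfolding two_one_sum_eq[OF assms]
  using schur_multiplier_even_odd[of "Suc k"]
  by (intro schur_multiplier_positive schur_multiplier_mult schur_multiplier_power
      schur_multiplier_power_sum_1) auto

lemma schur_positive_mult_multiplier:
  "schur_positive f \<Longrightarrow> schur_multiplier g \<Longrightarrow> schur_positive (\<lambda>N. f N * g N)"
  unfolding schur_multiplier_def by (simp add: mult.commute)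

text \<open>With \<open>(h + e)\<^sup>m = E + e Q\<close>, the sum over \<open>i\<close> is \<open>(3h\<^sup>2 + e\<^sup>2) E + (h\<^sup>3 + 3he\<^sup>2) Q\<close>. This absorbs the
  negative terms of \<open>p\<^sub>3 p\<^sub>1 (E + e Q)\<close> because \<open>p\<^sub>3 p\<^sub>1 + h\<^sup>2\<close> and \<open>h\<^sup>2 - he + e\<^sup>2\<close> are Schur-positive.\<close>

lemma schur_positive_three_one_sum_even:
  "schur_positive (\<lambda>N. power_sum 3 N * power_sum 1 N ^ (2 * m + 1)
     + (\<Sum>i\<le>m + 2. power_sum 2 N ^ i * power_sum 1 N ^ (2 * (m + 2) - 2 * i)))"
proof -
  define E Q where "E N = fst (even_odd m (hom2 N) (elem2 N))" and "Q N = snd (even_odd m (hom2 N) (elem2 N))" for N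
  define X Y where "X N = power_sum 3 N * power_sum 1 N + hom2 N ^ 2"
    and "Y N = hom2 N ^ 2 - hom2 N * elem2 N + elem2 N ^ 2" for N
  have "power_sum 3 N * power_sum 1 N ^ (2 * m + 1)
     + (\<Sum>i\<le>m + 2. power_sum 2 N ^ i * power_sum 1 N ^ (2 * (m + 2) - 2 * i))
     = X N * E N + (of_nat 2 * hom2 N ^ 2 + elem2 N ^ 2) * E N
       + (X N * (elem2 N * Q N) + (Y N * (hom2 N * Q N) + of_nat 2 * hom2 N * elem2 N ^ 2 * Q N))" for N
  proof -
    have p1: "power_sum 1 N ^ (2 * m + 1) = power_sum 1 N * (E N + elem2 N * Q N)"
      unfolding E_def Q_def power_add_even_odd[symmetric] power_sum_1_squared'[symmetric]
      by (simp add: power_mult power_even_eq)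
    have "(\<Sum>i\<le>m + 2. power_sum 2 N ^ i * power_sum 1 N ^ (2 * (m + 2) - 2 * i))
        = snd (even_odd (Suc (Suc (Suc m))) (hom2 N) (elem2 N))"
      by (subst two_one_sum_eq) simp_all
    \<comment> \<open>Three steps of the recursion lead from level \<open>m\<close> to level
      \<open>m + 3\<close>.\<close>
    also have "\<dots> = (3 * hom2 N ^ 2 + elem2 N ^ 2) * E N
        + (hom2 N ^ 3 + 3 * hom2 N * elem2 N ^ 2) * Q N"
      unfolding E_def Q_def by (simp add: case_prod_unfold) Groebner_Basis.algebra
    finally have sum: "(\<Sum>i\<le>m + 2. power_sum 2 N ^ i * power_sum 1 N ^ (2 * (m + 2) - 2 * i)) = \<dots>" .
    \<comment> \<open>Replacing \<open>p3 * p1\<close> by \<open>X - h^2\<close> leaves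
      \<open>h^3 - h^2*e + 3*h*e^2 = h*Y + 2*h*e^2\<close> as the remaining coefficient of
      \<open>Q\<close>.\<close>
    show ?thesis
      unfolding p1 sum X_def Y_def of_nat_numeral by Groebner_Basis.algebra
  qed
  moreover have "schur_positive (\<lambda>N. X N * E N + (of_nat 2 * hom2 N ^ 2 + elem2 N ^ 2) * E N
       + (X N * (elem2 N * Q N) + (Y N * (hom2 N * Q N) + of_nat 2 * hom2 N * elem2 N ^ 2 * Q N)))"
  proof -
    have EO: "schur_multiplier E" "schur_multiplier Q"
      using schur_multiplier_even_odd[of m] unfolding E_def Q_def by auto
    have XY: "schur_positive X" "schur_positive Y"
      unfolding X_def Y_def by (rule schur_positive_degree_4_hom schur_positive_degree_4_mixed)+
    note mults = schur_multiplier_add schur_multiplier_mult schur_multiplier_power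
      schur_multiplier_hom2 schur_multiplier_elem2 schur_multiplier_of_nat EO
    show ?thesis
      by (intro schur_positive_add schur_positive_mult_multiplier[OF XY(1)]
          schur_positive_mult_multiplier[OF XY(2)] schur_multiplier_positive mults)
  qed
  ultimately show ?thesis by simp
qed

text \<open>Even \<open>n\<close> from 4 on is the previous lemma, and odd \<open>n\<close> from 5
  on follows from \<open>n - 1\<close> by multiplying with \<open>p1\<close>.\<close>

lemma schur_positive_three_one_sum:
  assumes "3 \<le> n"
  shows "schur_positive (\<lambda>N. power_sum 3 N * power_sum 1 N ^ (n - 3)
     + (\<Sum>i\<le>n div 2. power_sum 2 N ^ i * power_sum 1 N ^ (n - 2 * i)))"
proof (cases "n = 3")
  case True
  have "(\<lambda>N. power_sum 3 N * power_sum 1 N ^ (n - 3)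
     + (\<Sum>i\<le>n div 2. power_sum 2 N ^ i * power_sum 1 N ^ (n - 2 * i)))
     = (\<lambda>N. power_sum 3 N + power_sum 1 N ^ 3 + power_sum 2 N * power_sum 1 N)"
    by (simp add: True fun_eq_iff)
  then show ?thesis using schur_positive_degree_3 by simp
next
  case False
  define m where "m = n div 2 - 2"
  have n: "n = 2 * (m + 2) \<or> n = Suc (2 * (m + 2))" using False assms by (auto simp: m_def)
  show ?thesis
  proof (cases "n = 2 * (m + 2)")
    case True
    then have "n - 3 = 2 * m + 1" "n div 2 = m + 2" by simp_all
    then show ?thesis using schur_positive_three_one_sum_even[of m] True by simp
  next
    case False
    then have odd: "n = Suc (2 * (m + 2))" using n by simp
    have "power_sum 3 N * power_sum 1 N ^ (n - 3)
       + (\<Sum>i\<le>n div 2. power_sum 2 N ^ i * power_sum 1 N ^ (n - 2 * i))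
       = power_sum 1 N * (power_sum 3 N * power_sum 1 N ^ (2 * m + 1)
       + (\<Sum>i\<le>m + 2. power_sum 2 N ^ i * power_sum 1 N ^ (2 * (m + 2) - 2 * i)))" for N
    proof -
      have "n - 3 = Suc (2 * m + 1)" "n div 2 = m + 2" using odd by simp_all
      moreover have "n - 2 * i = Suc (2 * (m + 2) - 2 * i)" if "i \<le> m + 2" for i
        using that odd by simp
      then have "(\<Sum>i\<le>m + 2. power_sum 2 N ^ i * power_sum 1 N ^ (n - 2 * i))
        = power_sum 1 N * (\<Sum>i\<le>m + 2. power_sum 2 N ^ i * power_sum 1 N ^ (2 * (m + 2) - 2 * i))"
        unfolding sum_distrib_left by (intro sum.cong) (auto simp: mult_ac)
      ultimately show ?thesis by (simp add: distrib_left mult.left_commute)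
    qed
    then show ?thesis
      using schur_positive_three_one_sum_even[of m] schur_multiplier_power_sum_1
      unfolding schur_multiplier_def by simp
  qed
qed

section \<open>Reverse lexicographic order\<close>

definition two_one :: "nat \<Rightarrow> nat \<Rightarrow> nat list" where
  "two_one n k = replicate k 2 @ replicate (n - 2 * k) 1"

lemma two_one_nth:
  "i < length (two_one n k) \<Longrightarrow> two_one n k ! i = (if i < k then 2 else 1)"
  by (auto simp: two_one_def nth_append)

lemma two_one_in_partitions: "2 * k \<le> n \<Longrightarrow> two_one n k \<in> partitions n"
  by (auto simp: partitions_def is_partition_def two_one_def sum_list_replicate
      sorted_wrt_iff_nth_less nth_append)

lemma inj_two_one: "inj (two_one n)"
proof (rule injI)
  fix k l assume "two_one n k = two_one n l"
  then have "length (filter (\<lambda>x. x = 2) (two_one n k)) = length (filter (\<lambda>x. x = 2) (two_one n l))"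
    by simp
  then show "k = l" by (simp add: two_one_def)
qed

lemma power_sum_part_two_one:
  "power_sum_part (two_one n k) N = power_sum 2 N ^ k * power_sum 1 N ^ (n - 2 * k)"
  by (simp add: power_sum_part_def two_one_def)

lemma partition_parts_le_2:
  assumes "is_partition la" "\<forall>x\<in>set la. x \<le> 2"
  shows "\<exists>k. 2 * k \<le> sum_list la \<and> la = two_one (sum_list la) k"
  using assms
proof (induction la)
  case Nil
  then show ?case by (simp add: two_one_def)
next
  case (Cons a la)
  then have "is_partition la" "\<forall>x\<in>set la. x \<le> 2" by (auto simp: is_partition_def)
  then obtain k where k: "2 * k \<le> sum_list la" "la = two_one (sum_list la) k" using Cons.IH by blast
  have "a = 1 \<or> a = 2" using Cons.prems by (force simp: is_partition_def)
  then show ?case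
  proof
    assume a: "a = 2"
    have "a # la = two_one (sum_list (a # la)) (Suc k)" using k(2) a by (simp add: two_one_def)
    moreover have "2 * Suc k \<le> sum_list (a # la)" using a k(1) by simp
    ultimately show ?thesis by blast
  next
    assume a: "a = 1"
    have "x = 1" if "x \<in> set la" for x
      using that Cons.prems a by (force simp: is_partition_def)
    then have "la = replicate (length la) 1" by (metis replicate_eqI)
    then have "a # la = two_one (sum_list (a # la)) 0"
      using a by (metis diff_zero append_Nil length_Cons mult_0_right replicate.simps sum_list_replicate
          mult.right_neutral two_one_def of_nat_id)
    moreover have "2 * 0 \<le> sum_list (a # la)" by simp
    ultimately show ?thesis by blast
  qed
qed

lemma partition_hd_bound:
  assumes "is_partition la" "la \<noteq> []" "la ! 0 \<le> m"
  shows "\<forall>x\<in>set la. x \<le> m"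
  using assms by (cases la) (auto simp: is_partition_def)

lemma partition_hd_le_2:
  assumes "la \<in> partitions n" "la \<noteq> [] \<longrightarrow> la ! 0 \<le> 2"
  obtains k where "2 * k \<le> n" "la = two_one n k"
proof -
  have la: "is_partition la" "sum_list la = n" using assms(1) by (auto simp: partitions_def)
  have "\<forall>x\<in>set la. x \<le> 2"
  proof (cases "la = []")
    case False
    then show ?thesis using partition_hd_bound[OF la(1)] assms(2) by blast
  qed simp
  then obtain k where "2 * k \<le> sum_list la" "la = two_one (sum_list la) k"
    using partition_parts_le_2[OF la(1)] by blast
  then show ?thesis using that unfolding la(2) by blast
qed

text \<open>Either the first part exceeds 1 and decides the comparison at index 0, or all parts are
  1.\<close>

lemma revlex_le_ones:
  assumes "la \<in> partitions n"
  shows "revlex_le (replicate n 1) la"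
proof (cases "la \<noteq> [] \<and> 1 < la ! 0")
  case True
  then have "0 < n" using assms by (cases la) (auto simp: partitions_def)
  then show ?thesis using True unfolding revlex_le_def by (intro disjI2 exI[of _ 0]) auto
next
  case False
  then have "\<forall>x\<in>set la. x \<le> 1"
    using assms partition_hd_bound[of la 1] by (cases "la = []") (auto simp: partitions_def)
  moreover have "\<forall>x\<in>set la. 0 < x" using assms by (auto simp: partitions_def is_partition_def)
  ultimately have "la = replicate (length la) 1" by (metis One_nat_def Suc_leI le_antisym replicate_eqI)
  moreover from this have "sum_list la = length la" by (metis mult.right_neutral of_nat_id sum_list_replicate)
  ultimately show ?thesis using assms by (simp add: revlex_le_def partitions_def)
qed

lemma revlex_le_two_one_iff:
  assumes la: "la \<in> partitions n" and k: "2 * k \<le> n"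
  shows "revlex_le la (two_one n k) \<longleftrightarrow> (\<exists>i\<le>k. la = two_one n i)"
proof
  assume le: "revlex_le la (two_one n k)"
  show "\<exists>i\<le>k. la = two_one n i"
  proof (cases "la = two_one n k")
    case False
    then obtain j where j: "j < length la" "j < length (two_one n k)"
      "take j la = take j (two_one n k)" "la ! j < two_one n k ! j"
      using le by (auto simp: revlex_le_def)
    \<comment> \<open>Where \<open>two_one n k\<close> has entry 1, no positive part can be
      smaller.\<close>
    have jk: "j < k"
    proof (rule ccontr)
      assume "\<not> j < k"
      then have "la ! j < 1" using j(4) two_one_nth[OF j(2)] by simp
      moreover have "0 < la ! j" using la j(1) by (auto simp: partitions_def is_partition_def)
      ultimately show False by simp
    qed
    have "la ! 0 \<le> 2"
    proof (cases j)
      case 0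
      then show ?thesis using j(4) two_one_nth[OF j(2)] by (simp split: if_splits)
    next
      case (Suc j')
      then have "la ! 0 = two_one n k ! 0" using j(3) by (metis nth_take zero_less_Suc)
      also have "\<dots> \<le> 2" using two_one_nth[OF le_less_trans[OF le0 j(2)]] by simp
      finally show ?thesis .
    qed
    then obtain i where i: "2 * i \<le> n" "la = two_one n i"
      using partition_hd_le_2[OF la] by blast
    \<comment> \<open>With more than \<open>k\<close> twos, \<open>la\<close> would also have a 2 at
      position \<open>j\<close>, against the strict inequality there.\<close>
    have "i \<le> k"
    proof (rule ccontr)
      assume "\<not> i \<le> k"
      then show False using j(4) jk two_one_nth[OF j(2)] two_one_nth[of j n i] j(1) i(2) by simp
    qed
    then show ?thesis using i by blast
  qed auto
next
  assume "\<exists>i\<le>k. la = two_one n i"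
  then obtain i where i: "i \<le> k" "la = two_one n i" by blast
  show "revlex_le la (two_one n k)"
  proof (cases "i = k")
    case True
    then show ?thesis using i by (simp add: revlex_le_def)
  next
    case False
    then have ik: "i < k" using i by simp
    then have len: "i < length (two_one n i)" "i < length (two_one n k)" using k by (auto simp: two_one_def)
    moreover have "take i (two_one n i) = take i (two_one n k)" using ik by (simp add: two_one_def)
    ultimately show ?thesis using ik i two_one_nth[OF len(1)] two_one_nth[OF len(2)]
      unfolding revlex_le_def by (intro disjI2 exI[of _ i]) simp
  qed
qed

text \<open>Past index 0 the bound consists of ones, so a first difference can only occur at index
  0; then the largest part is at most 2.\<close>

lemma revlex_le_three_oneD:
  assumes la: "la \<in> partitions n" and le: "revlex_le la (3 # replicate (n - 3) 1)"
  shows "(\<exists>k. 2 * k \<le> n \<and> la = two_one n k) \<or> la = 3 # replicate (n - 3) 1"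
proof (rule disjCI)
  assume "la \<noteq> 3 # replicate (n - 3) 1"
  then obtain j where j: "j < length la" "j < length (3 # replicate (n - 3) 1)"
    "la ! j < (3 # replicate (n - 3) 1) ! j"
    using le by (auto simp: revlex_le_def)
  have "0 < la ! j" using la j(1) by (auto simp: partitions_def is_partition_def)
  then have "j = 0" using j by (cases j) auto
  then have "la ! 0 \<le> 2" using j by simp
  then show "\<exists>k. 2 * k \<le> n \<and> la = two_one n k"
    using partition_hd_le_2[OF la] by blast
qed

lemma revlex_le_three_one_iff:
  assumes la: "la \<in> partitions n" and n: "3 \<le> n"
  shows "revlex_le la (3 # replicate (n - 3) 1) \<longleftrightarrow>
    la = 3 # replicate (n - 3) 1 \<or> (\<exists>i\<le>n div 2. la = two_one n i)"
proof
  assume "revlex_le la (3 # replicate (n - 3) 1)"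
  then show "la = 3 # replicate (n - 3) 1 \<or> (\<exists>i\<le>n div 2. la = two_one n i)"
    using revlex_le_three_oneD[OF la] by (auto simp: less_eq_div_iff_mult_less_eq mult.commute)
next
  assume "la = 3 # replicate (n - 3) 1 \<or> (\<exists>i\<le>n div 2. la = two_one n i)"
  then show "revlex_le la (3 # replicate (n - 3) 1)"
  proof
    assume "\<exists>i\<le>n div 2. la = two_one n i"
    then obtain i where i: "i \<le> n div 2" "la = two_one n i" by blast
    then have len: "0 < length (two_one n i)" using n by (auto simp: two_one_def)
    then have "la ! 0 < 3" using two_one_nth[OF len] i by simp
    then show ?thesis using i len unfolding revlex_le_def by (intro disjI2 exI[of _ 0]) simp
  qed (simp add: revlex_le_def)
qed

section \<open>Explicit sums for \<open>psi\<close> and the conclusion\<close>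

lemma psi_two_one:
  assumes k: "2 * k \<le> n"
  shows "psi (two_one n k) N = (\<Sum>i\<le>k. power_sum 2 N ^ i * power_sum 1 N ^ (n - 2 * i))"
proof -
  have sum: "sum_list (two_one n k) = n"
    using two_one_in_partitions[OF k] by (simp add: partitions_def)
  have "two_one n i \<in> partitions n" if "i \<le> k" for i
    using that k by (intro two_one_in_partitions) simp
  then have "la \<in> partitions n \<and> revlex_le (replicate n 1) la \<and> revlex_le la (two_one n k)
      \<longleftrightarrow> (\<exists>i\<le>k. la = two_one n i)" for la
    using revlex_le_two_one_iff[OF _ k, of la] revlex_le_ones[of la n] by blast
  then have "{la \<in> partitions n. revlex_le (replicate n 1) la \<and> revlex_le la (two_one n k)} = two_one n ` {..k}"
    by auto
  then show ?thesis
    unfolding psi_def sum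
    by (simp add: sum.reindex inj_on_subset[OF inj_two_one] power_sum_part_two_one)
qed

lemma psi_three_one:
  assumes n: "3 \<le> n"
  shows "psi (3 # replicate (n - 3) 1) N = power_sum 3 N * power_sum 1 N ^ (n - 3)
     + (\<Sum>i\<le>n div 2. power_sum 2 N ^ i * power_sum 1 N ^ (n - 2 * i))"
proof -
  let ?\<mu> = "3 # replicate (n - 3) (1::nat)"
  have sum: "sum_list ?\<mu> = n" using n by (simp add: sum_list_replicate)
  have \<mu>: "?\<mu> \<in> partitions n"
    using n by (auto simp: partitions_def is_partition_def sum_list_replicate sorted_wrt_iff_nth_less nth_Cons
        split: nat.splits)
  have "two_one n i \<in> partitions n" if "i \<le> n div 2" for i
    using that by (intro two_one_in_partitions) simp
  then have "la \<in> partitions n \<and> revlex_le (replicate n 1) la \<and> revlex_le la ?\<mu>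
      \<longleftrightarrow> la = ?\<mu> \<or> (\<exists>i\<le>n div 2. la = two_one n i)" for la
    using revlex_le_three_one_iff[OF _ n, of la] revlex_le_ones[of la n] \<mu> by blast
  then have "{la \<in> partitions n. revlex_le (replicate n 1) la \<and> revlex_le la ?\<mu>}
      = insert ?\<mu> (two_one n ` {..n div 2})"
    by auto
  moreover have "?\<mu> \<notin> two_one n ` {..n div 2}"
  proof
    assume "?\<mu> \<in> two_one n ` {..n div 2}"
    then obtain i where "?\<mu> = two_one n i" by blast
    then have "3 \<in> set (two_one n i)" by (metis list.set_intros(1))
    then show False by (auto simp: two_one_def)
  qed
  ultimately show ?thesis
    unfolding psi_def sum
    by (simp add: sum.reindex inj_on_subset[OF inj_two_one] power_sum_part_two_one)
      (simp add: power_sum_part_def)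
qed

theorem theorem2p11:
  fixes n :: nat and \<mu> :: "nat list"
  assumes "0 < n"
    and "\<mu> \<in> partitions n"
    and "revlex_le (replicate n 1) \<mu>"
    and "revlex_le \<mu> (3 # replicate (n - 3) 1)"
  shows "schur_positive (psi \<mu>)"
proof (cases "\<mu> = 3 # replicate (n - 3) 1")
  case True
  \<comment> \<open>For \<open>n < 3\<close> truncated subtraction turns the bound into
    \<open>[3]\<close>, which is not a partition of \<open>n\<close>.\<close>
  then have n: "3 \<le> n" using assms(2) by (auto simp: partitions_def)
  have "psi \<mu> = (\<lambda>N. power_sum 3 N * power_sum 1 N ^ (n - 3)
     + (\<Sum>i\<le>n div 2. power_sum 2 N ^ i * power_sum 1 N ^ (n - 2 * i)))"
    unfolding True by (rule ext) (rule psi_three_one[OF n])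
  then show ?thesis using schur_positive_three_one_sum[OF n] by simp
next
  case False
  then obtain k where k: "2 * k \<le> n" "\<mu> = two_one n k"
    using revlex_le_three_oneD[OF assms(2,4)] by blast
  have "psi \<mu> = (\<lambda>N. \<Sum>i\<le>k. power_sum 2 N ^ i * power_sum 1 N ^ (n - 2 * i))"
    unfolding k(2) by (rule ext) (rule psi_two_one[OF k(1)])
  then show ?thesis using schur_positive_two_one_sum[OF k(1)] by simp
qed

end
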